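(* Let $\mathcal{H}$ be a complex Hilbert space, let $\Omega$ be a sesquilinear form defined on a dense subspace $\mathcal{D}$ of $\mathcal{H}$, and let $\Upsilon$ be a bounded sesquilinear form on $\mathcal{H}$ such that $\Omega+\Upsilon$ is symmetric. Then $\Omega$ is solvable with respect to (the norm induced by) an inner product on $\mathcal{D}$ and $\Upsilon\in\mathfrak{P}(\Omega)$ if and only if the pair $(\mathcal{D},\Omega+\Upsilon)$ is a Krein space which is continuously embedded in $\mathcal{H}$.
   Context: Let $\|\cdot\|$ be the norm of $\mathcal{H}$. Sesquilinear forms are linear in the first variable and conjugate linear in the second; a form $\Omega$ is symmetric if $\Omega(\xi,\eta)=\overline{\Omega(\eta,\xi)}$ for all $\xi,\eta$ in its domain. Krein space: a pair $(\mathcal{D},[\cdot,\cdot])$ with $[\cdot,\cdot]$ a symmetric sesquilinear form on $\mathcal{D}$ admitting a decomposition $\mathcal{D}=\mathcal{D}_+\dotplus\mathcal{D}_-$, orthogonal with respect to $[\cdot,\cdot]$, such that $(\mathcal{D}_+,[\cdot,\cdot])$ and $(\mathcal{D}_-,-[\cdot,\cdot])$ are Hilbert spaces. Its topology is that of the Hilbert space $\mathcal{D}_+\oplus\mathcal{D}_-$ so obtained (independent of the decomposition). "Continuously embedded in $\mathcal{H}$" means that the inclusion $\mathcal{D}\hookrightarrow\mathcal{H}$ is continuous for this topology. A sesquilinear form $\Omega$ on the dense subspace $\mathcal{D}$ is q-closed with respect to a norm $\|\cdot\|_\Omega$ on $\mathcal{D}$ if: (1) there is $\alpha>0$ with $\|\xi\|\le\alpha\|\xi\|_\Omega$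 for all $\xi\in\mathcal{D}$; (2) if $\{\xi_n\}\subset\mathcal{D}$, $\|\xi_n\|\to0$ and $\|\xi_n-\xi_m\|_\Omega\to0$, then $\|\xi_n\|_\Omega\to0$; (3) $\mathcal{E}_\Omega:=\mathcal{D}[\|\cdot\|_\Omega]$ is a reflexive Banach space; (4) there is $\beta>0$ with $|\Omega(\xi,\eta)|\le\beta\|\xi\|_\Omega\|\eta\|_\Omega$ for all $\xi,\eta\in\mathcal{D}$. Let $\mathcal{E}_\Omega^\times$ be the conjugate dual of $\mathcal{E}_\Omega$ (bounded conjugate linear functionals). $\mathfrak{P}(\Omega)$ is the set of bounded sesquilinear forms $\Upsilon$ on $\mathcal{H}$ such that (i) if $\xi\in\mathcal{D}$ and $(\Omega+\Upsilon)(\xi,\eta)=0$ for all $\eta\in\mathcal{D}$, then $\xi=0$; (ii) for every $\Lambda\in\mathcal{E}_\Omega^\times$ there is $\xi\in\mathcal{D}$ with $\Lambda(\eta)=(\Omega+\Upsilon)(\xi,\eta)$ for all $\eta\in\mathcal{D}$. $\Omega$ is solvable with respect to $\|\cdot\|_\Omega$ if it is q-closed with respect to $\|\cdot\|_\Omega$ and $\mathfrak{P}(\Omega)\neq\varnothing$; it is solvable with respect to an inner product if it is solvable with respect to the norm induced by that inner product. *)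

theory Defs
  imports "HOL-Analysis.Analysis"
begin

section \<open>Complex Hilbert spaces\<close>

class complex_vector = real_vector +
  fixes scaleC :: "complex \<Rightarrow> 'a \<Rightarrow> 'a" (infixr "*\<^sub>C" 75)
  assumes scaleC_add_right: "a *\<^sub>C (x + y) = a *\<^sub>C x + a *\<^sub>C y"
    and scaleC_add_left: "(a + b) *\<^sub>C x = a *\<^sub>C x + b *\<^sub>C x"
    and scaleC_scaleC: "a *\<^sub>C b *\<^sub>C x = (a * b) *\<^sub>C x"
    and scaleC_one: "1 *\<^sub>C x = x"
    and scaleR_scaleC: "r *\<^sub>R x = complex_of_real r *\<^sub>C x"

global_interpretation complex_vector:
  vector_space "scaleC :: complex \<Rightarrow> 'a \<Rightarrow> 'a::complex_vector"
  by standard (simp_all add: scaleC_add_right scaleC_add_left scaleC_scaleC scaleC_one)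

abbreviation csubspace :: "'a::complex_vector set \<Rightarrow> bool" where
  "csubspace \<equiv> module.subspace scaleC"

text \<open>All sesquilinear forms, including the inner product, are linear in the first
  and conjugate linear in the second variable.\<close>

class complex_inner = complex_vector + real_normed_vector +
  fixes cinner :: "'a \<Rightarrow> 'a \<Rightarrow> complex"
  assumes cinner_commute: "cinner x y = cnj (cinner y x)"
    and cinner_add_left: "cinner (x + y) z = cinner x z + cinner y z"
    and cinner_scaleC_left: "cinner (a *\<^sub>C x) y = a * cinner x y"
    and norm_eq_sqrt_cinner: "norm x = sqrt (Re (cinner x x))"

class chilbert_space = complex_inner + complete_space

section \<open>Sesquilinear forms, norms and inner products on a subspace\<close>

text \<open>Forms and norms on a subspace \<open>D\<close> are total functions of which only the values on
  \<open>D\<close> matter.\<close>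

definition sesquilinear_on :: "'a::complex_vector set \<Rightarrow> ('a \<Rightarrow> 'a \<Rightarrow> complex) \<Rightarrow> bool" where
  "sesquilinear_on D \<Omega> \<longleftrightarrow>
     (\<forall>x\<in>D. \<forall>y\<in>D. \<forall>z\<in>D. \<Omega> (x + y) z = \<Omega> x z + \<Omega> y z) \<and>
     (\<forall>x\<in>D. \<forall>y\<in>D. \<forall>z\<in>D. \<Omega> x (y + z) = \<Omega> x y + \<Omega> x z) \<and>
     (\<forall>a. \<forall>x\<in>D. \<forall>y\<in>D. \<Omega> (a *\<^sub>C x) y = a * \<Omega> x y) \<and>
     (\<forall>a. \<forall>x\<in>D. \<forall>y\<in>D. \<Omega> x (a *\<^sub>C y) = cnj a * \<Omega> x y)"

definition symmetric_form_on :: "'a set \<Rightarrow> ('a \<Rightarrow> 'a \<Rightarrow> complex) \<Rightarrow> bool" where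
  "symmetric_form_on D \<Omega> \<longleftrightarrow> (\<forall>x\<in>D. \<forall>y\<in>D. \<Omega> x y = cnj (\<Omega> y x))"

definition form_add :: "('a \<Rightarrow> 'a \<Rightarrow> complex) \<Rightarrow> ('a \<Rightarrow> 'a \<Rightarrow> complex) \<Rightarrow> 'a \<Rightarrow> 'a \<Rightarrow> complex" where
  "form_add \<Omega> \<Upsilon> x y = \<Omega> x y + \<Upsilon> x y"

definition bounded_form :: "('a::complex_inner \<Rightarrow> 'a \<Rightarrow> complex) \<Rightarrow> bool" where
  "bounded_form \<Upsilon> \<longleftrightarrow> sesquilinear_on UNIV \<Upsilon> \<and>
     (\<exists>C. \<forall>x y. cmod (\<Upsilon> x y) \<le> C * norm x * norm y)"

definition norm_on :: "'a::complex_vector set \<Rightarrow> ('a \<Rightarrow> real) \<Rightarrow> bool" where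
  "norm_on D N \<longleftrightarrow>
     (\<forall>x\<in>D. 0 \<le> N x) \<and> (\<forall>x\<in>D. N x = 0 \<longleftrightarrow> x = 0) \<and>
     (\<forall>x\<in>D. \<forall>y\<in>D. N (x + y) \<le> N x + N y) \<and>
     (\<forall>a. \<forall>x\<in>D. N (a *\<^sub>C x) = cmod a * N x)"

definition inner_product_on :: "'a::complex_vector set \<Rightarrow> ('a \<Rightarrow> 'a \<Rightarrow> complex) \<Rightarrow> bool" where
  "inner_product_on D ip \<longleftrightarrow>
     sesquilinear_on D ip \<and> symmetric_form_on D ip \<and> (\<forall>x\<in>D. x \<noteq> 0 \<longrightarrow> 0 < Re (ip x x))"

definition induced_norm :: "('a \<Rightarrow> 'a \<Rightarrow> complex) \<Rightarrow> 'a \<Rightarrow> real" where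
  "induced_norm ip x = sqrt (Re (ip x x))"

text \<open>The locale \<open>Metric_space\<close> requires nonnegativity and symmetry of the distance also
  outside the carrier; hence the value \<open>0\<close> there.\<close>

definition norm_dist :: "'a::ab_group_add set \<Rightarrow> ('a \<Rightarrow> real) \<Rightarrow> 'a \<Rightarrow> 'a \<Rightarrow> real" where
  "norm_dist D N x y = (if x \<in> D \<and> y \<in> D then N (x - y) else 0)"

definition hilbert_on :: "'a::complex_vector set \<Rightarrow> ('a \<Rightarrow> 'a \<Rightarrow> complex) \<Rightarrow> bool" where
  "hilbert_on D ip \<longleftrightarrow> csubspace D \<and> inner_product_on D ip \<and>
     Metric_space.mcomplete D (norm_dist D (induced_norm ip))"

section \<open>Reflexive Banach spaces\<close>

text \<open>Functionals on \<open>D\<close> are represented by functions vanishing outside \<open>D\<close>, so that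
  equality of functionals is equality of functions and the dual is closed under the pointwise
  operations.\<close>

definition dual_on :: "'a::complex_vector set \<Rightarrow> ('a \<Rightarrow> real) \<Rightarrow> ('a \<Rightarrow> complex) set" where
  "dual_on D N = {f.
     (\<forall>x\<in>D. \<forall>y\<in>D. f (x + y) = f x + f y) \<and>
     (\<forall>a. \<forall>x\<in>D. f (a *\<^sub>C x) = a * f x) \<and>
     (\<exists>C. \<forall>x\<in>D. cmod (f x) \<le> C * N x) \<and>
     (\<forall>x. x \<notin> D \<longrightarrow> f x = 0)}"

definition conj_dual_on :: "'a::complex_vector set \<Rightarrow> ('a \<Rightarrow> real) \<Rightarrow> ('a \<Rightarrow> complex) set" where
  "conj_dual_on D N = {f.
     (\<forall>x\<in>D. \<forall>y\<in>D. f (x + y) = f x + f y) \<and>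
     (\<forall>a. \<forall>x\<in>D. f (a *\<^sub>C x) = cnj a * f x) \<and>
     (\<exists>C. \<forall>x\<in>D. cmod (f x) \<le> C * N x) \<and>
     (\<forall>x. x \<notin> D \<longrightarrow> f x = 0)}"

definition dual_norm_on :: "'a set \<Rightarrow> ('a \<Rightarrow> real) \<Rightarrow> ('a \<Rightarrow> complex) \<Rightarrow> real" where
  "dual_norm_on D N f = Sup {cmod (f x) |x. x \<in> D \<and> N x \<le> 1}"

definition bidual_functional ::
    "'a::complex_vector set \<Rightarrow> ('a \<Rightarrow> real) \<Rightarrow> (('a \<Rightarrow> complex) \<Rightarrow> complex) \<Rightarrow> bool" where
  "bidual_functional D N \<Phi> \<longleftrightarrow>
     (\<forall>f\<in>dual_on D N. \<forall>g\<in>dual_on D N. \<Phi> (\<lambda>x. f x + g x) = \<Phi> f + \<Phi> g) \<and>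
     (\<forall>a. \<forall>f\<in>dual_on D N. \<Phi> (\<lambda>x. a * f x) = a * \<Phi> f) \<and>
     (\<exists>C. \<forall>f\<in>dual_on D N. cmod (\<Phi> f) \<le> C * dual_norm_on D N f)"

text \<open>Reflexivity: the canonical map into the bidual is onto.\<close>

definition reflexive_banach_on :: "'a::complex_vector set \<Rightarrow> ('a \<Rightarrow> real) \<Rightarrow> bool" where
  "reflexive_banach_on D N \<longleftrightarrow>
     csubspace D \<and> norm_on D N \<and> Metric_space.mcomplete D (norm_dist D N) \<and>
     (\<forall>\<Phi>. bidual_functional D N \<Phi> \<longrightarrow> (\<exists>x\<in>D. \<forall>f\<in>dual_on D N. \<Phi> f = f x))"

section \<open>q-closed and solvable forms\<close>

definition q_closed ::
    "'a::complex_inner set \<Rightarrow> ('a \<Rightarrow> 'a \<Rightarrow> complex) \<Rightarrow> ('a \<Rightarrow> real) \<Rightarrow> bool" where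
  "q_closed D \<Omega> N \<longleftrightarrow>
     norm_on D N \<and>
     (\<exists>\<alpha>>0. \<forall>x\<in>D. norm x \<le> \<alpha> * N x) \<and>
     (\<forall>X. (\<forall>n. X n \<in> D) \<and> (\<lambda>n. norm (X n)) \<longlonglongrightarrow> 0 \<and>
          Metric_space.MCauchy D (norm_dist D N) X \<longrightarrow> (\<lambda>n. N (X n)) \<longlonglongrightarrow> 0) \<and>
     reflexive_banach_on D N \<and>
     (\<exists>\<beta>>0. \<forall>x\<in>D. \<forall>y\<in>D. cmod (\<Omega> x y) \<le> \<beta> * N x * N y)"

text \<open>The set \<open>\<PP>(\<Omega>)\<close>; it depends on the norm \<open>N\<close> through the conjugate dual.\<close>

definition solving_forms ::
    "'a::complex_inner set \<Rightarrow> ('a \<Rightarrow> 'a \<Rightarrow> complex) \<Rightarrow> ('a \<Rightarrow> real) \<Rightarrow> ('a \<Rightarrow> 'a \<Rightarrow> complex) set" where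
  "solving_forms D \<Omega> N = {\<Upsilon>. bounded_form \<Upsilon> \<and>
     (\<forall>x\<in>D. (\<forall>y\<in>D. form_add \<Omega> \<Upsilon> x y = 0) \<longrightarrow> x = 0) \<and>
     (\<forall>\<Lambda>\<in>conj_dual_on D N. \<exists>x\<in>D. \<forall>y\<in>D. \<Lambda> y = form_add \<Omega> \<Upsilon> x y)}"

definition solvable ::
    "'a::complex_inner set \<Rightarrow> ('a \<Rightarrow> 'a \<Rightarrow> complex) \<Rightarrow> ('a \<Rightarrow> real) \<Rightarrow> bool" where
  "solvable D \<Omega> N \<longleftrightarrow> q_closed D \<Omega> N \<and> solving_forms D \<Omega> N \<noteq> {}"

section \<open>Krein spaces\<close>

definition krein_decomposition ::
    "'a::complex_vector set \<Rightarrow> ('a \<Rightarrow> 'a \<Rightarrow> complex) \<Rightarrow> 'a set \<Rightarrow> 'a set \<Rightarrow> bool" where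
  "krein_decomposition D B Dp Dm \<longleftrightarrow>
     hilbert_on Dp B \<and> hilbert_on Dm (\<lambda>x y. - B x y) \<and>
     D = {p + m |p m. p \<in> Dp \<and> m \<in> Dm} \<and> Dp \<inter> Dm = {0} \<and>
     (\<forall>p\<in>Dp. \<forall>m\<in>Dm. B p m = 0)"

definition krein_space :: "'a::complex_vector set \<Rightarrow> ('a \<Rightarrow> 'a \<Rightarrow> complex) \<Rightarrow> bool" where
  "krein_space D B \<longleftrightarrow> csubspace D \<and> sesquilinear_on D B \<and> symmetric_form_on D B \<and>
     (\<exists>Dp Dm. krein_decomposition D B Dp Dm)"

definition component :: "'a::ab_group_add set \<Rightarrow> 'a set \<Rightarrow> 'a \<Rightarrow> 'a" where
  "component U V x = (THE u. u \<in> U \<and> x - u \<in> V)"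

text \<open>The inner product of the Hilbert space direct sum of \<open>(Dp, B)\<close> and \<open>(Dm, -B)\<close>.\<close>

definition krein_inner ::
    "('a::ab_group_add \<Rightarrow> 'a \<Rightarrow> complex) \<Rightarrow> 'a set \<Rightarrow> 'a set \<Rightarrow> 'a \<Rightarrow> 'a \<Rightarrow> complex" where
  "krein_inner B Dp Dm x y =
     B (component Dp Dm x) (component Dp Dm y) - B (component Dm Dp x) (component Dm Dp y)"

text \<open>The topology does not depend on the decomposition, so an arbitrary one is chosen.\<close>

definition krein_topology ::
    "'a::complex_vector set \<Rightarrow> ('a \<Rightarrow> 'a \<Rightarrow> complex) \<Rightarrow> 'a topology" where
  "krein_topology D B = (SOME T. \<exists>Dp Dm. krein_decomposition D B Dp Dm \<and>
     T = Metric_space.mtopology D (norm_dist D (induced_norm (krein_inner B Dp Dm))))"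

definition continuously_embedded_krein ::
    "'a::complex_inner set \<Rightarrow> ('a \<Rightarrow> 'a \<Rightarrow> complex) \<Rightarrow> bool" where
  "continuously_embedded_krein D B \<longleftrightarrow> continuous_map (krein_topology D B) euclidean (\<lambda>x. x)"

end

theory Submission
  imports Defs
begin

text \<open>Write \<open>B = \<Omega> + \<Upsilon>\<close>. If \<open>\<Omega>\<close> is solvable with respect to \<open>ip\<close>, then \<open>ip x y = B (G x) y\<close> for a
  symmetric operator \<open>G\<close> of the Hilbert space \<open>(D, ip)\<close> that is bounded (uniform boundedness) and
  bounded below. With \<open>R\<close> the positive square root of \<open>G\<^sup>2\<close>, the kernels of \<open>G - R\<close> and \<open>G + R\<close>
  form a Krein decomposition. For the topology of an arbitrary Krein decomposition, uniform
  boundedness shows that its norm is equivalent to that of \<open>ip\<close>. Conversely, the Hilbert inner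
  product of a Krein decomposition works: reflexivity and the surjectivity of \<open>B\<close> onto the conjugate
  dual follow from the Riesz representation theorem.\<close>

section \<open>Hilbert spaces on a subspace\<close>

text \<open>Because \<open>B (G x) y = ip x y\<close>, the form \<open>B\<close> is
  \<open>ip\<close> twisted by the inverse of \<open>G\<close>: the sign of \<open>B\<close> is the
  sign of \<open>G\<close>, and \<open>R\<close> acts as the absolute value of \<open>G\<close>. The
  splitting itself is algebra: \<open>R\<close> and \<open>G\<close> commute and have equal squares,
  so \<open>(R - G) (R + G) = 0\<close>, and \<open>R w\<close> is the sum of the halves of
  \<open>R w + G w\<close> and \<open>R w - G w\<close>; since \<open>R\<close> is onto, every
  vector is of this form. The lower bound on \<open>G\<close> is the boundedness of \<open>B\<close>
  read through \<open>G\<close>: \<open>|x|^2 = B (G x) x <= b |G x| |x|\<close>. It makes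
  \<open>1 - G^2 / C^2\<close> a strict contraction, so that a square root of
  \<open>G^2 / C^2\<close> comes from a geometrically convergent iteration, and the limit inherits a
  contraction bound from which \<open>R\<close> is positive definite and onto. The converse rests on
  the fundamental symmetry \<open>J\<close> of a decomposition, an isometric involution that
  exchanges \<open>B\<close> and the Hilbert inner product, so that each fact about the latter
  becomes one about \<open>B\<close>.\<close>

locale sesquilinear_form =
  fixes D :: "'a::complex_vector set" and B :: "'a \<Rightarrow> 'a \<Rightarrow> complex"
  assumes subspace: "csubspace D" and sesquilinear: "sesquilinear_on D B"
begin

lemma zero_in [simp]: "0 \<in> D"
  and add_in [simp]: "x \<in> D \<Longrightarrow> y \<in> D \<Longrightarrow> x + y \<in> D"
  and scale_in [simp]: "x \<in> D \<Longrightarrow> a *\<^sub>C x \<in> D"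
  and diff_in [simp]: "x \<in> D \<Longrightarrow> y \<in> D \<Longrightarrow> x - y \<in> D"
  and minus_in [simp]: "x \<in> D \<Longrightarrow> - x \<in> D"
  by (rule complex_vector.subspace_0[OF subspace] complex_vector.subspace_add[OF subspace]
      complex_vector.subspace_scale[OF subspace] complex_vector.subspace_diff[OF subspace]
      complex_vector.subspace_neg[OF subspace]; assumption)+

lemma add_left [simp]: "x \<in> D \<Longrightarrow> y \<in> D \<Longrightarrow> z \<in> D \<Longrightarrow> B (x + y) z = B x z + B y z"
  and add_right [simp]: "x \<in> D \<Longrightarrow> y \<in> D \<Longrightarrow> z \<in> D \<Longrightarrow> B x (y + z) = B x y + B x z"
  and scale_left [simp]: "x \<in> D \<Longrightarrow> y \<in> D \<Longrightarrow> B (a *\<^sub>C x) y = a * B x y"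
  and scale_right [simp]: "x \<in> D \<Longrightarrow> y \<in> D \<Longrightarrow> B x (a *\<^sub>C y) = cnj a * B x y"
  using sesquilinear unfolding sesquilinear_on_def by blast+

lemma minus_left [simp]: "x \<in> D \<Longrightarrow> y \<in> D \<Longrightarrow> B (- x) y = - B x y"
  using scale_left[of x y "-1"] by simp

lemma minus_right [simp]: "x \<in> D \<Longrightarrow> y \<in> D \<Longrightarrow> B x (- y) = - B x y"
  using scale_right[of x y "-1"] by simp

lemma diff_left [simp]: "x \<in> D \<Longrightarrow> y \<in> D \<Longrightarrow> z \<in> D \<Longrightarrow> B (x - y) z = B x z - B y z"
  using add_left[of x "- y" z] by simp

lemma diff_right [simp]: "x \<in> D \<Longrightarrow> y \<in> D \<Longrightarrow> z \<in> D \<Longrightarrow> B x (y - z) = B x y - B x z"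
  using add_right[of x y "- z"] by simp

lemma zero_left [simp]: "x \<in> D \<Longrightarrow> B 0 x = 0"
  using scale_left[of x x 0] by simp

lemma zero_right [simp]: "x \<in> D \<Longrightarrow> B x 0 = 0"
  using scale_right[of x x 0] by simp

end

section \<open>Inner products on a subspace: norm, convergence, operators\<close>

locale inner_space =
  fixes D :: "'a::complex_vector set" and ip :: "'a \<Rightarrow> 'a \<Rightarrow> complex"
  assumes csub: "csubspace D" and inner: "inner_product_on D ip"
begin

sublocale sesquilinear_form D ip
  using csub inner by unfold_locales (auto simp: inner_product_on_def)

abbreviation "N \<equiv> induced_norm ip"

lemma ip_commute: "x \<in> D \<Longrightarrow> y \<in> D \<Longrightarrow> ip x y = cnj (ip y x)"
  using inner unfolding inner_product_on_def symmetric_form_on_def by blast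

lemma ip_pos: "x \<in> D \<Longrightarrow> x \<noteq> 0 \<Longrightarrow> 0 < Re (ip x x)"
  using inner unfolding inner_product_on_def by blast

lemma ip_nonneg: "x \<in> D \<Longrightarrow> 0 \<le> Re (ip x x)"
  using ip_pos[of x] by (cases "x = 0") auto

lemma norm_sq: "x \<in> D \<Longrightarrow> (N x)\<^sup>2 = Re (ip x x)"
  by (simp add: induced_norm_def ip_nonneg)

lemma ip_self: "x \<in> D \<Longrightarrow> ip x x = of_real ((N x)\<^sup>2)"
  using ip_commute[of x x] by (simp add: norm_sq complex_eq_iff)

lemma norm_nonneg [simp]: "x \<in> D \<Longrightarrow> 0 \<le> N x"
  by (simp add: induced_norm_def ip_nonneg)

lemma norm_zero [simp]: "N 0 = 0"
  by (simp add: induced_norm_def)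

lemma norm_eq_0 [simp]: "x \<in> D \<Longrightarrow> N x = 0 \<longleftrightarrow> x = 0"
  using ip_pos[of x] by (cases "x = 0") (auto simp: induced_norm_def)

lemma norm_scale [simp]: assumes "x \<in> D" shows "N (a *\<^sub>C x) = cmod a * N x"
proof (rule power2_eq_imp_eq)
  have "ip (a *\<^sub>C x) (a *\<^sub>C x) = of_real ((cmod a)\<^sup>2) * ip x x"
    using assms complex_norm_square[of a] by simp
  then have "Re (ip (a *\<^sub>C x) (a *\<^sub>C x)) = (cmod a)\<^sup>2 * Re (ip x x)"
    by (simp only: Re_complex_of_real times_complex.sel Im_complex_of_real)
  then show "(N (a *\<^sub>C x))\<^sup>2 = (cmod a * N x)\<^sup>2"
    using assms by (simp only: norm_sq scale_in power_mult_distrib)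
qed (use assms in auto)

lemma norm_minus [simp]: "x \<in> D \<Longrightarrow> N (- x) = N x"
  using norm_scale[of x "-1"] by simp

lemma norm_minus_commute: "x \<in> D \<Longrightarrow> y \<in> D \<Longrightarrow> N (x - y) = N (y - x)"
  using norm_minus[of "x - y"] by simp

lemma norm_add_sq:
  "x \<in> D \<Longrightarrow> y \<in> D \<Longrightarrow> (N (x + y))\<^sup>2 = (N x)\<^sup>2 + 2 * Re (ip x y) + (N y)\<^sup>2"
  using ip_commute[of x y] by (simp add: norm_sq)

lemma norm_diff_sq:
  "x \<in> D \<Longrightarrow> y \<in> D \<Longrightarrow> (N (x - y))\<^sup>2 = (N x)\<^sup>2 - 2 * Re (ip x y) + (N y)\<^sup>2"
  using ip_commute[of x y] by (simp add: norm_sq)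

lemma Cauchy_Schwarz:
  assumes "x \<in> D" "y \<in> D" shows "cmod (ip x y) \<le> N x * N y"
proof (cases "y = 0")
  case False
  define n where "n = (N y)\<^sup>2"
  have n: "0 < n" using False assms by (simp add: n_def)
  \<comment> \<open>With this coefficient \<open>x - a *\<^sub>C y\<close> is the component of
    \<open>x\<close> orthogonal to \<open>y\<close>.\<close>
  define a where "a = ip x y / of_real n"
  have "0 \<le> (N (x - a *\<^sub>C y))\<^sup>2" by simp
  also have "\<dots> = (N x)\<^sup>2 - 2 * Re (cnj a * ip x y) + (cmod a)\<^sup>2 * n"
    using assms by (subst norm_diff_sq) (auto simp: n_def power_mult_distrib)
  also have "Re (cnj a * ip x y) = (cmod (ip x y))\<^sup>2 / n"
    using n by (simp add: a_def cmod_power2 field_simps) (simp add: power2_eq_square)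
  also have "(cmod a)\<^sup>2 * n = (cmod (ip x y))\<^sup>2 / n"
    using n by (simp add: a_def norm_divide power_divide power2_eq_square)
  finally have "(cmod (ip x y))\<^sup>2 / n \<le> (N x)\<^sup>2" by simp
  then have "(cmod (ip x y))\<^sup>2 \<le> (N x * N y)\<^sup>2"
    using n by (simp add: pos_divide_le_eq power_mult_distrib) (simp add: n_def)
  then show ?thesis
    by (rule power2_le_imp_le) (use assms in auto)
qed (use assms in auto)

lemma norm_triangle: assumes "x \<in> D" "y \<in> D" shows "N (x + y) \<le> N x + N y"
proof (rule power2_le_imp_le)
  have "Re (ip x y) \<le> N x * N y"
    using Cauchy_Schwarz[OF assms] complex_Re_le_cmod[of "ip x y"] by linarith
  then show "(N (x + y))\<^sup>2 \<le> (N x + N y)\<^sup>2"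
    using assms by (simp add: norm_add_sq power2_sum)
qed (use assms in auto)

lemma norm_triangle_diff: "x \<in> D \<Longrightarrow> y \<in> D \<Longrightarrow> N (x - y) \<le> N x + N y"
  using norm_triangle[of x "- y"] by simp

lemma norm_triangle_mid:
  "x \<in> D \<Longrightarrow> y \<in> D \<Longrightarrow> z \<in> D \<Longrightarrow> N (x - z) \<le> N (x - y) + N (y - z)"
  using norm_triangle[of "x - y" "y - z"] by simp

lemma norm_on_induced: "norm_on D N"
  unfolding norm_on_def by (auto intro: norm_triangle)

sublocale Metric_space D "norm_dist D N"
proof
  show "0 \<le> norm_dist D N x y" for x y by (simp add: norm_dist_def)
  show "norm_dist D N x y = norm_dist D N y x" for x y
    by (simp add: norm_dist_def norm_minus_commute)
qed (auto simp: norm_dist_def norm_triangle_mid)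

text \<open>Membership of all terms and of the limit is built in, so that limit arguments carry no
  separate carrier conditions; \<open>limitin_iff_conv\<close> links the notion to the metric
  topology.\<close>

definition conv :: "(nat \<Rightarrow> 'a) \<Rightarrow> 'a \<Rightarrow> bool" where
  "conv X x \<longleftrightarrow> (\<forall>n. X n \<in> D) \<and> x \<in> D \<and> (\<lambda>n. N (X n - x)) \<longlonglongrightarrow> 0"

lemma conv_in: "conv X x \<Longrightarrow> X n \<in> D" "conv X x \<Longrightarrow> x \<in> D"
  by (auto simp: conv_def)

lemma convI:
  assumes "\<And>n. X n \<in> D" "x \<in> D" "\<And>n. N (X n - x) \<le> e n" "e \<longlonglongrightarrow> 0"
  shows "conv X x"
  unfolding conv_def using assms
  by (auto intro!: tendsto_sandwich[OF _ _ tendsto_const[of 0] assms(4)])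

lemma conv_const: "x \<in> D \<Longrightarrow> conv (\<lambda>n. x) x"
  by (simp add: conv_def)

lemma conv_add:
  assumes "conv X x" "conv Y y" shows "conv (\<lambda>n. X n + Y n) (x + y)"
proof (rule convI)
  show "(\<lambda>n. N (X n - x) + N (Y n - y)) \<longlonglongrightarrow> 0"
    using assms by (auto simp: conv_def intro!: tendsto_add_zero)
  show "N (X n + Y n - (x + y)) \<le> N (X n - x) + N (Y n - y)" for n
    using norm_triangle[of "X n - x" "Y n - y"] assms by (simp add: conv_def algebra_simps)
qed (use assms in \<open>auto simp: conv_def\<close>)

lemma conv_scale:
  assumes "conv X x" shows "conv (\<lambda>n. a *\<^sub>C X n) (a *\<^sub>C x)"
proof (rule convI)
  show "(\<lambda>n. cmod a * N (X n - x)) \<longlonglongrightarrow> 0"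
    using assms by (auto simp: conv_def intro!: tendsto_mult_right_zero)
  show "N (a *\<^sub>C X n - a *\<^sub>C x) \<le> cmod a * N (X n - x)" for n
    using assms by (simp add: conv_def flip: complex_vector.scale_right_diff_distrib)
qed (use assms in \<open>auto simp: conv_def\<close>)

lemma conv_Suc: "conv X x \<Longrightarrow> conv (\<lambda>n. X (Suc n)) x"
  unfolding conv_def using LIMSEQ_Suc by blast

lemma conv_unique:
  assumes "conv X x" "conv X y" shows "x = y"
proof -
  have "conv (\<lambda>n. X n + (-1) *\<^sub>C X n) (x + (-1) *\<^sub>C y)"
    using assms by (intro conv_add conv_scale)
  then have "(\<lambda>n::nat. N (x - y)) \<longlonglongrightarrow> 0"
    using assms norm_minus_commute[of 0 "x - y"] by (simp add: conv_def)
  then have "N (x - y) = 0" using LIMSEQ_const_iff by blast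
  then show ?thesis using assms by (simp add: conv_def)
qed

lemma conv_ip:
  assumes "conv X x" "y \<in> D" shows "(\<lambda>n. ip (X n) y) \<longlonglongrightarrow> ip x y"
proof (rule Lim_null_comparison[THEN LIM_zero_cancel])
  show "\<forall>\<^sub>F n in sequentially. norm (ip (X n) y - ip x y) \<le> N (X n - x) * N y"
    using assms Cauchy_Schwarz[of "X _ - x" y] by (simp add: conv_def)
  show "(\<lambda>n. N (X n - x) * N y) \<longlonglongrightarrow> 0"
    using assms by (auto simp: conv_def intro: tendsto_mult_left_zero)
qed

lemma conv_norm:
  assumes "conv X x" shows "(\<lambda>n. N (X n)) \<longlonglongrightarrow> N x"
proof (rule Lim_null_comparison[THEN LIM_zero_cancel])
  show "\<forall>\<^sub>F n in sequentially. norm (N (X n) - N x) \<le> N (X n - x)"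
  proof (rule always_eventually, rule allI)
    fix n
    show "norm (N (X n) - N x) \<le> N (X n - x)"
      using norm_triangle[of "X n - x" x] norm_triangle[of "x - X n" "X n"]
        norm_minus_commute[of x "X n"] conv_in[OF assms] by simp
  qed
  show "(\<lambda>n. N (X n - x)) \<longlonglongrightarrow> 0" using assms by (simp add: conv_def)
qed

text \<open>The constant \<open>c\<close> is some admissible bound, not the operator norm: the later
  iterations need explicit bounds only.\<close>

definition bounded_op :: "('a \<Rightarrow> 'a) \<Rightarrow> real \<Rightarrow> bool" where
  "bounded_op L c \<longleftrightarrow> (\<forall>x\<in>D. L x \<in> D) \<and> (\<forall>x\<in>D. \<forall>y\<in>D. L (x + y) = L x + L y) \<and>
     (\<forall>a. \<forall>x\<in>D. L (a *\<^sub>C x) = a *\<^sub>C L x) \<and> (\<forall>x\<in>D. N (L x) \<le> c * N x)"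

definition symmetric_op :: "('a \<Rightarrow> 'a) \<Rightarrow> bool" where
  "symmetric_op L \<longleftrightarrow> (\<forall>x\<in>D. \<forall>y\<in>D. ip (L x) y = ip x (L y))"

lemma
  assumes "bounded_op L c"
  shows op_in: "x \<in> D \<Longrightarrow> L x \<in> D"
    and op_add: "x \<in> D \<Longrightarrow> y \<in> D \<Longrightarrow> L (x + y) = L x + L y"
    and op_scale: "x \<in> D \<Longrightarrow> L (a *\<^sub>C x) = a *\<^sub>C L x"
    and op_bound: "x \<in> D \<Longrightarrow> N (L x) \<le> c * N x"
  using assms by (auto simp: bounded_op_def)

lemma op_minus: "bounded_op L c \<Longrightarrow> x \<in> D \<Longrightarrow> L (- x) = - L x"
  using op_scale[of L c x "-1"] by simp

lemma op_diff: "bounded_op L c \<Longrightarrow> x \<in> D \<Longrightarrow> y \<in> D \<Longrightarrow> L (x - y) = L x - L y"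
  using op_add[of L c x "- y"] op_minus[of L c y] by simp

lemma op_zero: "bounded_op L c \<Longrightarrow> L 0 = 0"
  using op_scale[of L c 0 0] by simp

lemma conv_op:
  assumes "bounded_op L c" "conv X x" shows "conv (\<lambda>n. L (X n)) (L x)"
proof (rule convI)
  show "(\<lambda>n. c * N (X n - x)) \<longlonglongrightarrow> 0"
    using assms by (auto simp: conv_def intro!: tendsto_mult_right_zero)
  show "N (L (X n) - L x) \<le> c * N (X n - x)" for n
    using assms op_bound[of L c "X n - x"] op_diff[of L c] conv_in[OF assms(2)] by simp
qed (use assms in \<open>auto simp: conv_def op_in\<close>)

lemma MCauchy_iff:
  "MCauchy X \<longleftrightarrow> (\<forall>n. X n \<in> D) \<and> (\<forall>e>0. \<exists>M. \<forall>m\<ge>M. \<forall>n\<ge>M. N (X m - X n) < e)"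
proof -
  have "norm_dist D N (X m) (X n) = N (X m - X n)" if "\<forall>n. X n \<in> D" for m n
    using that by (simp add: norm_dist_def)
  then show ?thesis unfolding MCauchy_def by (auto simp: image_subset_iff)
qed

lemma limitin_iff_conv: "(\<forall>n. X n \<in> D) \<Longrightarrow> limitin mtopology X x sequentially \<longleftrightarrow> conv X x"
  by (auto simp: limit_metric_sequentially conv_def norm_dist_def LIMSEQ_iff)

lemma mcomplete_iff: "mcomplete \<longleftrightarrow> (\<forall>X. MCauchy X \<longrightarrow> (\<exists>x. conv X x))"
  unfolding mcomplete_def using limitin_iff_conv MCauchy_iff by blast

end

section \<open>Consequences of completeness: uniform boundedness and Riesz representation\<close>

locale hilbert_space_on = inner_space +
  assumes complete: "mcomplete"
begin

text \<open>Summing the geometric series bounds all later increments. Every limit built from scratch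
  below (gliding hump, minimising sequence, fixed points) comes from here; the explicit tail bound
  is what the gliding hump needs.\<close>

lemma conv_geometric:
  assumes X: "\<And>n. X n \<in> D" and q: "0 \<le> q" "q < 1" and c: "0 \<le> c"
    and step: "\<And>n. N (X (Suc n) - X n) \<le> c * q ^ n"
  obtains x where "conv X x" "\<And>n. N (X n - x) \<le> c * q ^ n / (1 - q)"
proof -
  have partial: "N (X (n + k) - X n) \<le> c * q ^ n * (1 - q ^ k) / (1 - q)" for n k
  proof (induction k)
    case (Suc k)
    have "N (X (n + Suc k) - X n) \<le> c * q ^ (n + k) + c * q ^ n * (1 - q ^ k) / (1 - q)"
      using norm_triangle_mid[of "X (n + Suc k)" "X (n + k)" "X n"] step[of "n + k"] Suc X
      by auto
    also have "\<dots> = c * q ^ n * (1 - q ^ Suc k) / (1 - q)"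
      using q by (simp add: field_simps power_add)
    finally show ?case .
  qed simp
  have tail: "N (X (n + k) - X n) \<le> c * q ^ n / (1 - q)" for n k
  proof (rule order_trans[OF partial])
    have "c * q ^ n * (1 - q ^ k) \<le> c * q ^ n * 1"
      using q c by (intro mult_left_mono) auto
    then show "c * q ^ n * (1 - q ^ k) / (1 - q) \<le> c * q ^ n / (1 - q)"
      using q by (intro divide_right_mono) auto
  qed
  have lim0: "(\<lambda>n. c * q ^ n / (1 - q)) \<longlonglongrightarrow> 0"
    using q by (auto intro!: tendsto_divide_zero tendsto_mult_right_zero LIMSEQ_power_zero)
  have "MCauchy X"
    unfolding MCauchy_iff
  proof (intro conjI allI impI X)
    fix e :: real assume "0 < e"
    then obtain M where M: "c * q ^ M / (1 - q) < e / 2"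
      using order_tendstoD(2)[OF lim0, of "e / 2"] eventually_happens'[OF sequentially_bot]
      by auto
    have "N (X m - X n) < e" if "M \<le> m" "M \<le> n" for m n
    proof -
      have "N (X m - X M) \<le> c * q ^ M / (1 - q)" "N (X M - X n) \<le> c * q ^ M / (1 - q)"
        using norm_minus_commute[of "X M" "X n"] tail[of M "m - M"] tail[of M "n - M"] that X
        by auto
      then show ?thesis
        using norm_triangle_mid[OF X X X, of m n M] M by linarith
    qed
    then show "\<exists>M. \<forall>m\<ge>M. \<forall>n\<ge>M. N (X m - X n) < e" by blast
  qed
  then obtain x where x: "conv X x" using complete mcomplete_iff by blast
  have "N (X n - x) \<le> c * q ^ n / (1 - q)" for n
  proof (rule LIMSEQ_le_const2)
    have "conv (\<lambda>k. X n + (-1) *\<^sub>C X (k + n)) (X n + (-1) *\<^sub>C x)"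
      using x LIMSEQ_ignore_initial_segment[of "\<lambda>k. N (X k - x)" 0 n]
      by (intro conv_add conv_scale conv_const X) (auto simp: conv_def)
    then show "(\<lambda>k. N (X n - X (k + n))) \<longlonglongrightarrow> N (X n - x)"
      using conv_norm by fastforce
    show "\<exists>M. \<forall>k\<ge>M. N (X n - X (k + n)) \<le> c * q ^ n / (1 - q)"
      using tail[of n] norm_minus_commute X by (simp add: add.commute)
  qed
  with x that show ?thesis by blast
qed

text \<open>Sokal's gliding hump: if \<open>|v n|\<close> grows faster than \<open>4 ^ n\<close>, steps of size \<open>4 ^ -n\<close> can be
  chosen to keep \<open>ip (x (n + 1)) (v n)\<close> large, and the later steps are too small to undo this.\<close>

lemma uniform_boundedness:
  assumes V: "V \<subseteq> D" and bdd: "\<And>x. x \<in> D \<Longrightarrow> \<exists>M. \<forall>v\<in>V. cmod (ip x v) \<le> M"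
  obtains C where "0 < C" "\<And>v. v \<in> V \<Longrightarrow> N v \<le> C"
proof (rule ccontr)
  note bound = that
  assume "\<not> thesis"
  then have *: "\<exists>v\<in>V. \<not> N v \<le> C" if "0 < C" for C using bound[OF that] by blast
  \<comment> \<open>The factor 6 is 1 / (1/2 - 1/3): a hump of at least
    \<open>q ^ n * N (v n) / 2\<close> loses at most \<open>q ^ n * N (v n) / 3\<close> to the later
    steps. The factor \<open>4 ^ n\<close> cancels \<open>q ^ n\<close>.\<close>
  have "\<exists>v\<in>V. 6 * real (Suc n) * 4 ^ n < N v" for n
    using *[of "6 * real (Suc n) * 4 ^ n"] by (auto simp: not_le)
  then obtain v where v: "\<And>n. v n \<in> V" "\<And>n. 6 * real (Suc n) * 4 ^ n < N (v n)" by metis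
  have vD: "v n \<in> D" for n using v V by auto
  have vpos: "0 < N (v n)" for n
    by (rule order.strict_trans[OF _ v(2)]) simp
  define q :: real where "q = 1 / 4"
  have "\<exists>X. \<forall>n. X n \<in> D \<and> (X (Suc n) \<in> D \<and> N (X (Suc n) - X n) \<le> q ^ n \<and>
      q ^ n * N (v n) / 2 \<le> cmod (ip (X (Suc n)) (v n)))"
  proof (rule dependent_nat_choice[where P = "\<lambda>_ x. x \<in> D", simplified])
    show "\<exists>x. x \<in> D" using zero_in by blast
  next
    fix x n assume x: "x \<in> D"
    define h where "h = complex_of_real (q ^ n / N (v n)) *\<^sub>C v n"
    have h: "h \<in> D" by (simp add: h_def vD)
    have Nh: "N h = q ^ n"
      using vpos[of n] by (cases "v n = 0") (simp_all add: h_def vD q_def norm_divide norm_mult norm_power)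
    have ih: "ip h (v n) = of_real (q ^ n * N (v n))"
      using vpos[of n] by (cases "v n = 0") (simp_all add: h_def vD ip_self power2_eq_square)
    have "cmod (ip h (v n)) = q ^ n * N (v n)"
      unfolding ih norm_of_real using vpos[of n] by (simp add: q_def)
    \<comment> \<open>The vector \<open>h\<close> points along \<open>v n\<close> and has length
      \<open>q ^ n\<close>. As \<open>h\<close> is the difference of \<open>x + h\<close> and
      \<open>x\<close>, one of these two has at least half of the pairing of \<open>h\<close> with
      \<open>v n\<close>, so either adding \<open>h\<close> or staying at \<open>x\<close>
      works.\<close>
    moreover have "cmod (ip h (v n)) \<le> cmod (ip (x + h) (v n)) + cmod (ip x (v n))"
      using norm_triangle_ineq4[of "ip (x + h) (v n)" "ip x (v n)"] x h vD by simp
    ultimately consider "q ^ n * N (v n) / 2 \<le> cmod (ip (x + h) (v n))"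
      | "q ^ n * N (v n) / 2 \<le> cmod (ip x (v n))" by linarith
    then show "\<exists>y. y \<in> D \<and> y \<in> D \<and> N (y - x) \<le> q ^ n \<and> q ^ n * N (v n) / 2 \<le> cmod (ip y (v n))"
    proof cases
      case 1 then show ?thesis using x h Nh by (intro exI[of _ "x + h"]) auto
    next
      case 2 then show ?thesis using x by (intro exI[of _ x]) (auto simp: q_def)
    qed
  qed
  then obtain X where X: "\<And>n. X n \<in> D" "\<And>n. N (X (Suc n) - X n) \<le> 1 * q ^ n"
    "\<And>n. q ^ n * N (v n) / 2 \<le> cmod (ip (X (Suc n)) (v n))" by auto
  obtain x where x: "conv X x" "\<And>n. N (X n - x) \<le> 1 * q ^ n / (1 - q)"
    by (rule conv_geometric[of X q 1]) (use X in \<open>auto simp: q_def\<close>)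
  have xD: "x \<in> D" using x conv_in by blast
  have large: "real (Suc n) \<le> cmod (ip x (v n))" for n
  proof -
    have "cmod (ip (X (Suc n)) (v n)) \<le> cmod (ip x (v n)) + cmod (ip (X (Suc n) - x) (v n))"
      using norm_triangle_ineq[of "ip x (v n)" "ip (X (Suc n) - x) (v n)"] xD X vD by simp
    also have "cmod (ip (X (Suc n) - x) (v n)) \<le> q ^ n / 3 * N (v n)"
      using x(2)[of "Suc n"] vpos[of n]
      by (intro order_trans[OF Cauchy_Schwarz] mult_right_mono) (auto simp: X xD vD q_def)
    finally have "q ^ n * N (v n) / 6 \<le> cmod (ip x (v n))" using X(3)[of n] by simp
    moreover have "q ^ n * (6 * real (Suc n) * 4 ^ n) \<le> q ^ n * N (v n)"
      using v(2)[of n] by (intro mult_left_mono) (auto simp: q_def)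
    ultimately show ?thesis by (simp add: q_def power_one_over)
  qed
  obtain M where M: "\<forall>w\<in>V. cmod (ip x w) \<le> M" using bdd xD by blast
  obtain n where "M < real n" using reals_Archimedean2 by blast
  then show False using M large[of n] v(1)[of n] by (auto dest!: bspec[of V _ "v n"])
qed

text \<open>The representing vector minimises \<open>|x|\<^sup>2 - 2 Re (f x)\<close>.\<close>

lemma riesz_representation:
  assumes add: "\<And>x y. x \<in> D \<Longrightarrow> y \<in> D \<Longrightarrow> f (x + y) = f x + f y"
    and scale: "\<And>a x. x \<in> D \<Longrightarrow> f (a *\<^sub>C x) = a * f x"
    and bound: "\<And>x. x \<in> D \<Longrightarrow> cmod (f x) \<le> C * N x"
  obtains z where "z \<in> D" "\<And>x. x \<in> D \<Longrightarrow> f x = ip x z"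
proof -
  define \<phi> where "\<phi> x = (N x)\<^sup>2 - 2 * Re (f x)" for x
  define m where "m = Inf (\<phi> ` D)"
  have "- C\<^sup>2 \<le> \<phi> x" if "x \<in> D" for x
  proof -
    \<comment> \<open>Completing the square: \<open>|x|^2 - 2 C |x|\<close> is at least
      \<open>- C^2\<close>.\<close>
    have "Re (f x) \<le> C * N x"
      using bound[OF that] complex_Re_le_cmod[of "f x"] by linarith
    moreover have "0 \<le> (N x - C)\<^sup>2" by simp
    ultimately show ?thesis by (simp add: \<phi>_def power2_diff mult.commute[of C])
  qed
  then have bb: "bdd_below (\<phi> ` D)" by (rule bdd_belowI2)
  have m: "m \<le> \<phi> x" if "x \<in> D" for x
    unfolding m_def using that bb by (auto intro: cInf_lower)
  \<comment> \<open>The rate \<open>(1/4) ^ n\<close> is chosen so that \<open>par\<close> bounds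
    successive distances by a multiple of \<open>(1/2) ^ n\<close>, which makes the minimising
    sequence itself geometric.\<close>
  have "\<exists>x\<in>D. \<phi> x < m + (1/4) ^ n" for n
    using cInf_lessD[of "\<phi> ` D" "m + (1/4) ^ n", folded m_def] zero_in by (fastforce simp del: zero_in)
  then obtain X where X: "\<And>n. X n \<in> D" "\<And>n. \<phi> (X n) < m + (1/4) ^ n" by metis
  \<comment> \<open>Parallelogram identity: the linear terms cancel, and \<open>\<phi>\<close> at
    the midpoint of \<open>x\<close> and \<open>y\<close> is at least \<open>m\<close>.\<close>
  have par: "(N (x - y))\<^sup>2 \<le> 2 * (\<phi> x + \<phi> y - 2 * m)" if "x \<in> D" "y \<in> D" for x y
  proof -
    have "4 * \<phi> ((1/2) *\<^sub>C (x + y)) = (N (x + y))\<^sup>2 - 4 * Re (f x + f y)"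
      unfolding \<phi>_def using that
      by (simp only: norm_scale scale add add_in) (simp add: norm_divide power_divide field_simps)
    then show ?thesis
      using m[OF scale_in[OF add_in[OF that]], of "1/2"] norm_add_sq[OF that] norm_diff_sq[OF that]
      unfolding \<phi>_def[of x] \<phi>_def[of y]
      by (simp only: plus_complex.sel distrib_left right_diff_distrib)
  qed
  obtain z where z: "conv X z"
  proof (rule conv_geometric[of X "1/2" 2])
    show "N (X (Suc n) - X n) \<le> 2 * (1/2) ^ n" for n
    proof (rule power2_le_imp_le)
      have "(N (X (Suc n) - X n))\<^sup>2 \<le> 2 * ((1/4) ^ Suc n + (1/4) ^ n)"
        using par[of "X (Suc n)" "X n"] X(1) X(2)[of n] X(2)[of "Suc n"] by simp
      also have "\<dots> \<le> 4 * (1/4) ^ n" by simp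
      also have "\<dots> = (2 * (1/2) ^ n)\<^sup>2"
        by (simp add: power_mult_distrib power_divide flip: power_mult) (simp add: power_mult mult.commute[of n 2])
      finally show "(N (X (Suc n) - X n))\<^sup>2 \<le> (2 * (1/2) ^ n)\<^sup>2" .
    qed simp
  qed (use X in auto)
  have zD: "z \<in> D" using z conv_in by blast
  have f_diff: "f (x - y) = f x - f y" if "x \<in> D" "y \<in> D" for x y
    using add[of x "- y"] scale[of y "-1"] that by simp
  have "(\<lambda>n. f (X n)) \<longlonglongrightarrow> f z"
  proof (rule Lim_null_comparison[THEN LIM_zero_cancel])
    show "\<forall>\<^sub>F n in sequentially. norm (f (X n) - f z) \<le> C * N (X n - z)"
      using bound[of "X _ - z"] X zD by (simp add: f_diff)
    show "(\<lambda>n. C * N (X n - z)) \<longlonglongrightarrow> 0"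
      using z by (auto simp: conv_def intro: tendsto_mult_right_zero)
  qed
  then have "(\<lambda>n. \<phi> (X n)) \<longlonglongrightarrow> \<phi> z"
    unfolding \<phi>_def by (intro tendsto_intros conv_norm z)
  moreover have "(\<lambda>n. m + (1/4) ^ n) \<longlonglongrightarrow> m + 0"
    by (intro tendsto_intros LIMSEQ_power_zero) simp
  ultimately have "\<phi> z \<le> m + 0"
    by (rule LIMSEQ_le) (use X(2) less_imp_le in blast)
  then have min: "\<phi> z \<le> \<phi> x" if "x \<in> D" for x using m[OF that] by simp
  have "f x = ip x z" if x: "x \<in> D" for x
  proof -
    define g where "g = f x - ip x z"
    \<comment> \<open>A step size for the variation \<open>z + w\<close>: since
      \<open>s * (N x)\<^sup>2 < 1\<close>, the first-order gain \<open>2 s |g|^2\<close> would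
      exceed the second-order cost \<open>s^2 |g|^2 |x|^2\<close> unless
      \<open>g = 0\<close>.\<close>
    define s where "s = 1 / ((N x)\<^sup>2 + 1)"
    have s: "0 < s" "s * (N x)\<^sup>2 < 1"
    proof -
      have "0 < (N x)\<^sup>2 + 1" by (rule add_nonneg_pos) simp_all
      then show "0 < s" "s * (N x)\<^sup>2 < 1" by (simp_all add: s_def pos_divide_less_eq)
    qed
    define w where "w = (of_real s * cnj g) *\<^sub>C x"
    have w: "w \<in> D" by (simp add: w_def x)
    have "\<phi> z \<le> \<phi> (z + w)" using min zD w by simp
    then have "2 * Re (f w - ip w z) \<le> (N w)\<^sup>2"
      using ip_commute[of w z] by (simp add: \<phi>_def norm_add_sq zD w add)
    moreover have "f w - ip w z = of_real (s * (cmod g)\<^sup>2)"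
      by (simp add: w_def x zD scale flip: right_diff_distrib g_def)
        (use complex_norm_square[of g] in \<open>simp add: mult.commute\<close>)
    moreover have "(N w)\<^sup>2 = s\<^sup>2 * (cmod g)\<^sup>2 * (N x)\<^sup>2"
      by (simp add: w_def x norm_mult power_mult_distrib)
    ultimately have "2 * (s * (cmod g)\<^sup>2) \<le> s * (cmod g)\<^sup>2 * (s * (N x)\<^sup>2)"
      by (simp add: power2_eq_square algebra_simps)
    also have "\<dots> \<le> s * (cmod g)\<^sup>2 * 1"
      using s by (intro mult_left_mono) auto
    finally have "s * (cmod g)\<^sup>2 \<le> 0" by simp
    then have "g = 0" using s by (simp add: mult_le_0_iff)
    then show ?thesis by (simp add: g_def)
  qed
  with zD that show ?thesis by blast
qed

end

lemma hilbert_on_iff: "hilbert_on D ip \<longleftrightarrow> hilbert_space_on D ip"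
  by (auto simp: hilbert_on_def hilbert_space_on_def hilbert_space_on_axioms_def inner_space_def)

section \<open>Neumann series and square roots of symmetric operators\<close>

context hilbert_space_on
begin

text \<open>The iterates of \<open>x \<mapsto> y + S x\<close> started at \<open>y\<close> are the
  partial sums of the Neumann series of \<open>1 - S\<close>. This yields the surjectivity of
  \<open>R\<close>.\<close>

lemma ex_diff_contraction:
  assumes S: "bounded_op S r" and r: "0 \<le> r" "r < 1" and y: "y \<in> D"
  shows "\<exists>x\<in>D. x - S x = y"
proof -
  define X where "X = rec_nat y (\<lambda>_ x. y + S x)"
  have X: "X 0 = y" "X (Suc n) = y + S (X n)" for n by (simp_all add: X_def)
  have XD: "X n \<in> D" for n by (induction n) (auto simp: X y op_in[OF S])
  have step: "N (X (Suc n) - X n) \<le> N y * r ^ n" for n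
  proof (induction n)
    case 0
    have "r * N y \<le> 1 * N y" using r y by (intro mult_right_mono) auto
    then show ?case using op_bound[OF S y] by (simp add: X)
  next
    case (Suc n)
    have "X (Suc (Suc n)) - X (Suc n) = S (X (Suc n) - X n)"
      unfolding X(2)[of "Suc n"] op_diff[OF S XD XD] using X(2)[of n] by simp
    then have "N (X (Suc (Suc n)) - X (Suc n)) \<le> r * N (X (Suc n) - X n)"
      using op_bound[OF S, of "X (Suc n) - X n"] XD by simp
    also have "\<dots> \<le> r * (N y * r ^ n)" using Suc r by (intro mult_left_mono) auto
    finally show ?case by (simp add: mult_ac)
  qed
  obtain x where x: "conv X x"
    by (rule conv_geometric[of X r "N y"]) (use XD step r y in auto)
  have "conv (\<lambda>n. X (Suc n)) (y + S x)"
    unfolding X using conv_add[OF conv_const[OF y] conv_op[OF S x]] .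
  then have "x = y + S x" by (rule conv_unique[OF conv_Suc[OF x]])
  then have "x - S x = y" by (simp only: diff_eq_eq)
  then show ?thesis using conv_in[OF x] by blast
qed

text \<open>The fixed point of \<open>S = (K + S\<^sup>2) / 2\<close> satisfies \<open>(1 - S)\<^sup>2 = 1 - K\<close>; the iteration is a
  contraction on operators of norm at most \<open>r = 1 - sqrt (1 - k)\<close>.\<close>

lemma symmetric_contraction_sqrt:
  assumes K: "bounded_op K k" "symmetric_op K" and k: "0 \<le> k" "k < 1"
  obtains S r where "0 \<le> r" "r < 1" "bounded_op S r" "symmetric_op S"
    "\<And>x. x \<in> D \<Longrightarrow> S x + S x = K x + S (S x)"
    "\<And>L c x. bounded_op L c \<Longrightarrow> (\<And>x. x \<in> D \<Longrightarrow> L (K x) = K (L x)) \<Longrightarrow> x \<in> D \<Longrightarrow> L (S x) = S (L x)"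
proof -
  \<comment> \<open>The smaller root of \<open>r^2 - 2 r + k = 0\<close>. Hence
    \<open>(k + r * r) / 2 = r\<close>, and the bound \<open>r\<close> reproduces itself along the
    iteration.\<close>
  define r where "r = 1 - sqrt (1 - k)"
  have r: "0 \<le> r" "r < 1" using k by (simp_all add: r_def)
  have r_eq: "k + r * r = 2 * r"
  proof -
    have "sqrt (1 - k) * sqrt (1 - k) = 1 - k" using k by simp
    then show ?thesis unfolding r_def by algebra
  qed
  define S where "S = rec_nat (\<lambda>x. 0) (\<lambda>n T x. (1/2) *\<^sub>C (K x + T (T x)))"
  have S: "S 0 x = 0" "S (Suc n) x = (1/2) *\<^sub>C (K x + S n (S n x))" for n x
    by (simp_all add: S_def)
  have bS: "bounded_op (S n) r" for n
  proof (induction n)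
    case 0
    show ?case using r by (simp add: bounded_op_def S)
  next
    case (Suc n)
    note [simp] = op_in[OF Suc] op_in[OF K(1)] op_add[OF Suc] op_add[OF K(1)]
      op_scale[OF Suc] op_scale[OF K(1)]
    have "N (S (Suc n) x) \<le> r * N x" if x: "x \<in> D" for x
    proof -
      have "N (S n (S n x)) \<le> r * (r * N x)"
        by (rule order_trans[OF op_bound[OF Suc]])
          (use op_bound[OF Suc x] r x in \<open>auto intro: mult_left_mono\<close>)
      then have "N (K x + S n (S n x)) \<le> (k + r * r) * N x"
        using norm_triangle[of "K x" "S n (S n x)"] op_bound[OF K(1) x] x
        by (simp add: algebra_simps)
      then show ?thesis using x by (simp add: S r_eq norm_divide)
    qed
    then show ?case
      unfolding bounded_op_def
      by (simp add: S complex_vector.scale_right_distrib mult.commute)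
  qed
  note [simp] = op_in[OF bS] op_in[OF K(1)] op_add[OF bS] op_scale[OF bS] op_add[OF K(1)] op_diff[OF bS]
  have sS: "symmetric_op (S n)" for n
  proof (induction n)
    case 0 show ?case by (simp add: symmetric_op_def S)
  next
    case (Suc n)
    then show ?case using K(2) by (simp add: symmetric_op_def S)
  qed
  \<comment> \<open>Each \<open>S n\<close> is a polynomial in \<open>K\<close>, so it commutes with
    whatever commutes with \<open>K\<close>; in particular the iterates commute with one
    another.\<close>
  have comm: "L (S n x) = S n (L x)"
    if L: "bounded_op L c" and LK: "\<And>x. x \<in> D \<Longrightarrow> L (K x) = K (L x)" and "x \<in> D" for L c n x
    using \<open>x \<in> D\<close>
  proof (induction n arbitrary: x)
    case 0 show ?case by (simp add: S op_zero[OF L])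
  next
    case (Suc n)
    then show ?case
      by (simp add: S op_scale[OF L] op_add[OF L] op_in[OF L] LK)
  qed
  have commK: "S n (K x) = K (S n x)" if "x \<in> D" for n x
    using comm[OF K(1), of x n] that by simp
  have commS: "S m (S n x) = S n (S m x)" if "x \<in> D" for m n x
    using comm[OF bS, of m x n] commK that by simp
  have step: "N (S (Suc n) x - S n x) \<le> N x * r ^ n" if x: "x \<in> D" for x n
  proof (induction n)
    case 0
    have "k * N x \<le> 2 * N x" using k x by (intro mult_right_mono) auto
    then show ?case using op_bound[OF K(1) x] x
      by (simp add: S norm_divide)
  next
    case (Suc n)
    define d where "d = S (Suc n) x - S n x"
    have d: "d \<in> D" by (simp add: d_def x)
    have "S (Suc (Suc n)) x - S (Suc n) x = (1/2) *\<^sub>C (S (Suc n) (S (Suc n) x) - S n (S n x))"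
      unfolding S(2)[of "Suc n" x] S(2)[of n x]
      by (simp flip: complex_vector.scale_right_diff_distrib)
    \<comment> \<open>Difference of squares factored as sum times difference, legitimate because the
      iterates commute. The sum has bound \<open>2 r\<close>, and the outer factor 1/2 leaves the
      contraction factor \<open>r\<close>.\<close>
    also have "S (Suc n) (S (Suc n) x) - S n (S n x) = S (Suc n) d + S n d"
      using commS[OF x, of "Suc n" n] x by (simp add: d_def del: S(2))
    finally have "N (S (Suc (Suc n)) x - S (Suc n) x) \<le> (N (S (Suc n) d) + N (S n d)) / 2"
      using norm_triangle[of "S (Suc n) d" "S n d"] d by (simp add: norm_divide)
    also have "\<dots> \<le> r * N d" using op_bound[OF bS d, of n] op_bound[OF bS d, of "Suc n"] by simp
    also have "\<dots> \<le> r * (N x * r ^ n)" using Suc r by (intro mult_left_mono) (auto simp: d_def)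
    finally show ?case by (simp add: mult_ac)
  qed
  have "\<exists>y. conv (\<lambda>n. S n x) y" if x: "x \<in> D" for x
    by (rule conv_geometric[of "\<lambda>n. S n x" r "N x"]) (use x step r in auto)
  then obtain T where T: "\<And>x. x \<in> D \<Longrightarrow> conv (\<lambda>n. S n x) (T x)" by metis
  note TD [simp] = conv_in(2)[OF T]
  have bT: "bounded_op T r"
    unfolding bounded_op_def
  proof (intro conjI ballI allI)
    show "T (x + y) = T x + T y" if "x \<in> D" "y \<in> D" for x y
      by (rule conv_unique[OF T]) (use conv_add[OF T T, of x y] that in auto)
    show "T (a *\<^sub>C x) = a *\<^sub>C T x" if "x \<in> D" for a x
      by (rule conv_unique[OF T]) (use conv_scale[OF T, of x a] that in auto)
    show "N (T x) \<le> r * N x" if "x \<in> D" for x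
      by (rule LIMSEQ_le_const2[OF conv_norm[OF T]]) (use op_bound[OF bS] that in auto)
  qed simp
  have sT: "symmetric_op T"
    unfolding symmetric_op_def
  proof (intro ballI)
    fix x y assume xy: "x \<in> D" "y \<in> D"
    have "(\<lambda>n. cnj (ip (S n y) x)) \<longlonglongrightarrow> cnj (ip (T y) x)"
      by (intro tendsto_intros conv_ip T xy)
    moreover have "cnj (ip (S n y) x) = ip (S n x) y" for n
      using ip_commute[of "S n y" x] sS[of n] xy by (simp add: symmetric_op_def)
    ultimately have "ip (T x) y = cnj (ip (T y) x)"
      using LIMSEQ_unique[OF conv_ip[OF T]] xy by auto
    then show "ip (T x) y = ip x (T y)" using ip_commute[of x "T y"] xy by simp
  qed
  have commT: "L (T x) = T (L x)"
    if L: "bounded_op L c" and LK: "\<And>x. x \<in> D \<Longrightarrow> L (K x) = K (L x)" and x: "x \<in> D" for L c x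
  proof (rule conv_unique[OF conv_op[OF L T[OF x]]])
    have "L (S n x) = S n (L x)" for n by (rule comm[OF L _ x]) (rule LK)
    then show "conv (\<lambda>n. L (S n x)) (T (L x))"
      using T[OF op_in[OF L x]] by (simp only:)
  qed
  have fixed: "T x + T x = K x + T (T x)" if x: "x \<in> D" for x
  proof -
    \<comment> \<open>Pointwise convergence alone would not pass to the composition; the common
      bound \<open>r\<close> of all \<open>S n\<close> controls the inner error.\<close>
    have "conv (\<lambda>n. S n (S n x)) (T (T x))"
    proof (rule convI)
      show "(\<lambda>n. r * N (S n x - T x) + N (S n (T x) - T (T x))) \<longlonglongrightarrow> 0"
        using T[OF x] T[of "T x"] x
        by (auto simp: conv_def intro!: tendsto_add_zero tendsto_mult_right_zero)
      show "N (S n (S n x) - T (T x)) \<le> r * N (S n x - T x) + N (S n (T x) - T (T x))" for n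
        using norm_triangle_mid[of "S n (S n x)" "S n (T x)" "T (T x)"]
          op_bound[OF bS, of "S n x - T x" n] x by simp
    qed (use x in auto)
    then have "conv (\<lambda>n. S (Suc n) x) ((1/2) *\<^sub>C (K x + T (T x)))"
      unfolding S by (intro conv_scale conv_add conv_const) (use x in auto)
    then have "T x = (1/2) *\<^sub>C (K x + T (T x))"
      by (rule conv_unique[OF conv_Suc[OF T[OF x]]])
    then have "T x + T x = (1/2) *\<^sub>C (K x + T (T x)) + (1/2) *\<^sub>C (K x + T (T x))"
      by (rule arg_cong2[where f = "(+)"]) fact
    then show ?thesis by (simp only: flip: complex_vector.scale_left_distrib) simp
  qed
  show thesis
    by (rule that[OF r bT sT fixed commT])
qed

text \<open>Take \<open>R = C (1 - S)\<close>, where \<open>S\<close> is the fixed point belonging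
  to \<open>K = 1 - G^2 / C^2\<close>; then \<open>(1 - S)^2 = 1 - K = G^2 / C^2\<close>. The bound
  \<open>r < 1\<close> on \<open>S\<close> gives both coercivity, with \<open>d = C (1 - r)\<close>,
  and surjectivity. The condition \<open>c \<le> C\<close> keeps the radicand of \<open>k\<close>
  nonnegative.\<close>

lemma bounded_below_symmetric_sqrt:
  assumes G: "bounded_op G C" "symmetric_op G" and c: "0 < c" "c \<le> C"
    and below: "\<And>x. x \<in> D \<Longrightarrow> c * N x \<le> N (G x)"
  obtains R C' d where "bounded_op R C'" "symmetric_op R" "0 < d"
    "\<And>x. x \<in> D \<Longrightarrow> R (G x) = G (R x)" "\<And>x. x \<in> D \<Longrightarrow> R (R x) = G (G x)"
    "\<And>x. x \<in> D \<Longrightarrow> d * (N x)\<^sup>2 \<le> Re (ip (R x) x)" "\<And>y. y \<in> D \<Longrightarrow> \<exists>x\<in>D. R x = y"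
proof -
  define t where "t = 1 / C\<^sup>2"
  have C: "0 < C" using c by simp
  have t: "0 < t" "t * C\<^sup>2 = 1" using C by (simp_all add: t_def)
  note [simp] = op_in[OF G(1)] op_add[OF G(1)] op_scale[OF G(1)] op_diff[OF G(1)]
  define K where "K x = x - of_real t *\<^sub>C G (G x)" for x
  define k where "k = sqrt (1 - c\<^sup>2 * t)"
  have ct: "0 < c\<^sup>2 * t" "c\<^sup>2 * t \<le> 1"
    using c t power_mono[of c C 2] mult_right_mono[of "c\<^sup>2" "C\<^sup>2" t] by (auto simp: mult.commute)
  have k: "0 \<le> k" "k < 1" using ct by (simp_all add: k_def)
  have bK: "bounded_op K k"
    unfolding bounded_op_def
  proof (intro conjI ballI allI)
    show "N (K x) \<le> k * N x" if x: "x \<in> D" for x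
    proof (rule power2_le_imp_le)
      \<comment> \<open>By symmetry the cross term is \<open>- 2 t |G x|^2\<close>; since
        \<open>t C^2 = 1\<close>, the quadratic term is at most \<open>t |G x|^2\<close>. The
        remaining \<open>- t |G x|^2\<close> is made strictly contracting by the lower bound on
        \<open>G\<close>.\<close>
      have "ip x (G (G x)) = ip (G x) (G x)"
        using G(2) x by (simp add: symmetric_op_def)
      then have "(N (K x))\<^sup>2 = (N x)\<^sup>2 - 2 * t * (N (G x))\<^sup>2 + t\<^sup>2 * (N (G (G x)))\<^sup>2"
        using x t by (simp add: K_def norm_diff_sq power_mult_distrib ip_self)
      also have "t\<^sup>2 * (N (G (G x)))\<^sup>2 \<le> t\<^sup>2 * (C * N (G x))\<^sup>2"
        using x op_bound[OF G(1), of "G x"] by (intro mult_left_mono power_mono) auto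
      also have "t\<^sup>2 * (C * N (G x))\<^sup>2 = t * (t * C\<^sup>2) * (N (G x))\<^sup>2"
        by (simp only: power_mult_distrib power2_eq_square mult_ac)
      also have "\<dots> = t * (N (G x))\<^sup>2" by (simp only: t(2) mult_1_right)
      finally have "(N (K x))\<^sup>2 \<le> (N x)\<^sup>2 - t * (N (G x))\<^sup>2" by simp
      moreover have "t * (c * N x)\<^sup>2 \<le> t * (N (G x))\<^sup>2"
        using below[OF x] x c t by (intro mult_left_mono power_mono) auto
      ultimately have "(N (K x))\<^sup>2 \<le> (1 - c\<^sup>2 * t) * (N x)\<^sup>2"
        by (simp add: power_mult_distrib algebra_simps)
      then show "(N (K x))\<^sup>2 \<le> (k * N x)\<^sup>2"
        using ct by (simp add: k_def power_mult_distrib)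
    qed (use k x in auto)
  qed (simp_all add: K_def algebra_simps complex_vector.scale_right_distrib
      complex_vector.scale_right_diff_distrib)
  have sK: "symmetric_op K"
    using G(2) by (simp add: symmetric_op_def K_def)
  have GK: "G (K x) = K (G x)" if "x \<in> D" for x using that by (simp add: K_def)
  obtain S r where r: "0 \<le> r" "r < 1" and S: "bounded_op S r" "symmetric_op S"
    and SS: "\<And>x. x \<in> D \<Longrightarrow> S x + S x = K x + S (S x)"
    and comm: "\<And>L c x. bounded_op L c \<Longrightarrow> (\<And>x. x \<in> D \<Longrightarrow> L (K x) = K (L x)) \<Longrightarrow> x \<in> D
      \<Longrightarrow> L (S x) = S (L x)"
    by (rule symmetric_contraction_sqrt[OF bK sK k]) blast
  note [simp] = op_in[OF S(1)] op_add[OF S(1)] op_scale[OF S(1)] op_diff[OF S(1)]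
  define R where "R x = of_real C *\<^sub>C (x - S x)" for x
  show thesis
  proof (rule that)
    show "bounded_op R (C * (1 + r))"
      unfolding bounded_op_def
    proof (intro conjI ballI allI)
      show "N (R x) \<le> C * (1 + r) * N x" if x: "x \<in> D" for x
      proof -
        have "N (x - S x) \<le> (1 + r) * N x"
          using norm_triangle_diff[of x "S x"] op_bound[OF S(1) x] x by (simp add: algebra_simps)
        then show ?thesis using x C by (simp add: R_def)
      qed
    qed (simp_all add: R_def algebra_simps complex_vector.scale_right_distrib
      complex_vector.scale_right_diff_distrib)
    show "symmetric_op R" using S(2) by (simp add: symmetric_op_def R_def)
    show "0 < C * (1 - r)" using C r by simp
    show "R (G x) = G (R x)" if "x \<in> D" for x
      using comm[OF G(1) GK that] that by (simp add: R_def)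
    show "R (R x) = G (G x)" if x: "x \<in> D" for x
    proof -
      have "R (R x) = of_real (C * C) *\<^sub>C (x - S x - S (x - S x))"
        using x by (simp add: R_def complex_vector.scale_right_diff_distrib)
      also have "x - S x - S (x - S x) = x - (S x + S x) + S (S x)"
        using x by simp
      also have "\<dots> = of_real t *\<^sub>C G (G x)"
        unfolding SS[OF x] by (simp add: K_def)
      finally show ?thesis using t(2) by (simp add: power2_eq_square mult.commute flip: of_real_mult)
    qed
    show "C * (1 - r) * (N x)\<^sup>2 \<le> Re (ip (R x) x)" if x: "x \<in> D" for x
    proof -
      have "Re (ip (S x) x) \<le> N (S x) * N x"
        using Cauchy_Schwarz[of "S x" x] complex_Re_le_cmod[of "ip (S x) x"] x by simp
      also have "\<dots> \<le> r * N x * N x" using op_bound[OF S(1) x] x by (intro mult_right_mono) auto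
      finally have "(1 - r) * (N x)\<^sup>2 \<le> Re (ip (x - S x) x)"
        using x by (simp add: norm_sq[symmetric]) (simp add: algebra_simps power2_eq_square)
      then have "C * ((1 - r) * (N x)\<^sup>2) \<le> C * Re (ip (x - S x) x)"
        using C by (intro mult_left_mono) auto
      then show ?thesis using x by (simp add: R_def mult.assoc)
    qed
    show "\<exists>x\<in>D. R x = y" if y: "y \<in> D" for y
    proof -
      obtain x where x: "x \<in> D" "x - S x = of_real (1 / C) *\<^sub>C y"
        using ex_diff_contraction[OF S(1) r, of "of_real (1 / C) *\<^sub>C y"] y by auto
      then have "R x = y" using C by (simp add: R_def flip: of_real_mult)
      then show ?thesis using x by blast
    qed
  qed
qed

end

section \<open>Automatic boundedness and reflexivity\<close>

context inner_space
begin

text \<open>Rescaling to the unit sphere. The function \<open>f\<close> is left general because the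
  lemma serves the norm of an operator value, the norm of a Krein decomposition and the norm of the
  ambient space.\<close>

lemma homogeneous_bound:
  assumes hom: "\<And>a x. x \<in> D \<Longrightarrow> f (of_real a *\<^sub>C x) = \<bar>a\<bar> * f x"
    and ball: "\<And>x. x \<in> D \<Longrightarrow> N x \<le> 1 \<Longrightarrow> f x \<le> C" and x: "x \<in> D"
  shows "f x \<le> C * N x"
proof (cases "x = 0")
  case True
  then show ?thesis using hom[of 0 0] by simp
next
  case False
  then have pos: "0 < N x" using x norm_nonneg[of x] norm_eq_0[of x] by linarith
  have "f (of_real (1 / N x) *\<^sub>C x) \<le> C"
    using pos x False by (intro ball) (auto simp: norm_divide)
  then show ?thesis using pos unfolding hom[OF x] by (simp add: pos_divide_le_eq)
qed

end

context hilbert_space_on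
begin

text \<open>Uniform boundedness for the image of the unit ball: symmetry turns
  \<open>ip x (L z)\<close> into \<open>ip (L x) z\<close>, which is at most \<open>N (L x)\<close>
  there.\<close>

lemma Hellinger_Toeplitz:
  assumes "\<And>x. x \<in> D \<Longrightarrow> L x \<in> D" "\<And>x y. x \<in> D \<Longrightarrow> y \<in> D \<Longrightarrow> L (x + y) = L x + L y"
    and scale: "\<And>a x. x \<in> D \<Longrightarrow> L (a *\<^sub>C x) = a *\<^sub>C L x" and sym: "symmetric_op L"
  obtains C where "0 < C" "bounded_op L C"
proof -
  obtain C where C: "0 < C" "\<And>v. v \<in> {L z |z. z \<in> D \<and> N z \<le> 1} \<Longrightarrow> N v \<le> C"
  proof (rule uniform_boundedness)
    show "\<exists>M. \<forall>v\<in>{L z |z. z \<in> D \<and> N z \<le> 1}. cmod (ip x v) \<le> M" if x: "x \<in> D" for x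
    proof (intro exI ballI)
      fix v assume "v \<in> {L z |z. z \<in> D \<and> N z \<le> 1}"
      then obtain z where z: "z \<in> D" "N z \<le> 1" "v = L z" by blast
      have "ip x v = ip (L x) z" using sym x z by (simp add: symmetric_op_def)
      then have "cmod (ip x v) \<le> N (L x) * N z" using Cauchy_Schwarz assms(1) x z by simp
      also have "\<dots> \<le> N (L x) * 1" using assms(1) x z by (intro mult_left_mono) auto
      finally show "cmod (ip x v) \<le> N (L x)" by simp
    qed
  qed (use assms in auto)
  have "N (L x) \<le> C * N x" if "x \<in> D" for x
    by (rule homogeneous_bound) (use C assms that in auto)
  then have "bounded_op L C" using assms by (simp add: bounded_op_def)
  with C that show thesis by blast
qed

text \<open>Riesz twice: once to write every functional as some \<open>F z\<close>, once for
  \<open>z \<mapsto> cnj (\<Phi> (F z))\<close>. The conjugation compensates for \<open>F\<close>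
  being conjugate linear in \<open>z\<close>.\<close>

lemma reflexive: "reflexive_banach_on D N"
  unfolding reflexive_banach_on_def
proof (intro conjI allI impI csub norm_on_induced complete)
  fix \<Phi> assume "bidual_functional D N \<Phi>"
  then have add: "\<And>f g. f \<in> dual_on D N \<Longrightarrow> g \<in> dual_on D N \<Longrightarrow> \<Phi> (\<lambda>x. f x + g x) = \<Phi> f + \<Phi> g"
    and scale: "\<And>a f. f \<in> dual_on D N \<Longrightarrow> \<Phi> (\<lambda>x. a * f x) = a * \<Phi> f"
    and "\<exists>C. \<forall>f\<in>dual_on D N. cmod (\<Phi> f) \<le> C * dual_norm_on D N f"
    unfolding bidual_functional_def by blast+
  then obtain C where C: "\<And>f. f \<in> dual_on D N \<Longrightarrow> cmod (\<Phi> f) \<le> C * dual_norm_on D N f" by blast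
  define F where "F z x = (if x \<in> D then ip x z else 0)" for z x
  have F: "F z \<in> dual_on D N" if z: "z \<in> D" for z
  proof -
    have "cmod (ip x z) \<le> N z * N x" if "x \<in> D" for x
      using Cauchy_Schwarz[OF that z] by (simp add: mult.commute)
    then show ?thesis unfolding dual_on_def using z by (auto simp: F_def)
  qed
  have bound: "cmod (\<Phi> (F z)) \<le> \<bar>C\<bar> * N z" if z: "z \<in> D" for z
  proof -
    let ?S = "{cmod (F z x) |x. x \<in> D \<and> N x \<le> 1}"
    have le: "s \<le> N z" if s: "s \<in> ?S" for s
    proof -
      obtain x where x: "x \<in> D" "N x \<le> 1" "s = cmod (F z x)" using s by blast
      have "N x * N z \<le> 1 * N z" using x z by (intro mult_right_mono) auto
      then show ?thesis using Cauchy_Schwarz[OF x(1) z] x by (simp add: F_def)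
    qed
    \<comment> \<open>\<open>dual_norm_on\<close> is a bare \<open>Sup\<close>, so estimating it
      from either side needs a nonempty, bounded set. The absolute value of \<open>C\<close> enters
      because the sign of \<open>C\<close> is unknown.\<close>
    have 0: "0 \<in> ?S" using z by (auto intro!: exI[of _ 0] simp: F_def)
    have "0 \<le> dual_norm_on D N (F z)" unfolding dual_norm_on_def
      by (rule cSup_upper[OF 0]) (use le in \<open>rule bdd_aboveI\<close>)
    moreover have "dual_norm_on D N (F z) \<le> N z" unfolding dual_norm_on_def
      by (rule cSup_least) (use 0 le in blast)+
    ultimately have "C * dual_norm_on D N (F z) \<le> \<bar>C\<bar> * N z"
      by (intro mult_mono) auto
    then show ?thesis using C[OF F[OF z]] by linarith
  qed
  obtain x where x: "x \<in> D" "\<And>z. z \<in> D \<Longrightarrow> cnj (\<Phi> (F z)) = ip z x"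
  proof (rule riesz_representation[of "\<lambda>z. cnj (\<Phi> (F z))" "\<bar>C\<bar>"])
    show "cnj (\<Phi> (F (z + w))) = cnj (\<Phi> (F z)) + cnj (\<Phi> (F w))" if "z \<in> D" "w \<in> D" for z w
    proof -
      have "F (z + w) = (\<lambda>x. F z x + F w x)" using that by (auto simp: F_def)
      then show ?thesis using add[OF F F] that by simp
    qed
    show "cnj (\<Phi> (F (a *\<^sub>C z))) = a * cnj (\<Phi> (F z))" if "z \<in> D" for a z
    proof -
      have "F (a *\<^sub>C z) = (\<lambda>x. cnj a * F z x)" using that by (auto simp: F_def)
      then show ?thesis using scale[OF F] that by simp
    qed
  qed (use bound in auto)
  have "\<Phi> f = f x" if f: "f \<in> dual_on D N" for f
  proof -
    obtain K where K: "\<forall>x\<in>D. cmod (f x) \<le> K * N x" using f unfolding dual_on_def by blast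
    obtain z where z: "z \<in> D" "\<And>x. x \<in> D \<Longrightarrow> f x = ip x z"
      by (rule riesz_representation[of f K]) (use f K in \<open>auto simp: dual_on_def\<close>)
    have "f = F z" using z f by (auto simp: F_def dual_on_def)
    moreover have "\<Phi> (F z) = ip x z"
      using x(2)[OF z(1)] ip_commute[OF x(1) z(1)] by (metis complex_cnj_cnj)
    ultimately show ?thesis using z x(1) by simp
  qed
  then show "\<exists>x\<in>D. \<forall>f\<in>dual_on D N. \<Phi> f = f x" using x(1) by blast
qed

lemma conj_riesz_representation:
  assumes "\<Lambda> \<in> conj_dual_on D N" obtains z where "z \<in> D" "\<And>y. y \<in> D \<Longrightarrow> \<Lambda> y = ip z y"
proof -
  obtain K where K: "\<forall>x\<in>D. cmod (\<Lambda> x) \<le> K * N x"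
    using assms unfolding conj_dual_on_def by blast
  obtain z where z: "z \<in> D" "\<And>y. y \<in> D \<Longrightarrow> cnj (\<Lambda> y) = ip y z"
    by (rule riesz_representation[of "\<lambda>y. cnj (\<Lambda> y)" K]) (use assms K in \<open>auto simp: conj_dual_on_def\<close>)
  have "\<Lambda> y = ip z y" if "y \<in> D" for y
    using z(2)[OF that] ip_commute[OF z(1) that] by (metis complex_cnj_cnj)
  with z that show thesis by blast
qed

end


section \<open>The decomposition defined by a square root\<close>

text \<open>The assumptions survive replacing \<open>B\<close> and \<open>G\<close> by their
  negatives with the same \<open>R\<close>. The negative half of the decomposition is therefore the
  positive half of the flipped instance.\<close>

locale square_root_splitting = hilbert_space_on D ip + B: sesquilinear_form D B
  for D :: "'a::complex_vector set" and ip B :: "'a \<Rightarrow> 'a \<Rightarrow> complex" +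
  fixes G R :: "'a \<Rightarrow> 'a" and C C' b d :: real
  assumes B_sym: "symmetric_form_on D B"
    and B_bound: "\<And>x y. x \<in> D \<Longrightarrow> y \<in> D \<Longrightarrow> cmod (B x y) \<le> b * N x * N y"
    and B_G: "\<And>x y. x \<in> D \<Longrightarrow> y \<in> D \<Longrightarrow> B (G x) y = ip x y"
    and G: "bounded_op G C" "symmetric_op G" and C: "0 < C"
    and R: "bounded_op R C'" "symmetric_op R" and d: "0 < d"
    and R_G: "\<And>x. x \<in> D \<Longrightarrow> R (G x) = G (R x)"
    and R_R: "\<And>x. x \<in> D \<Longrightarrow> R (R x) = G (G x)"
    and R_pos: "\<And>x. x \<in> D \<Longrightarrow> d * (N x)\<^sup>2 \<le> Re (ip (R x) x)"
    and R_surj: "\<And>y. y \<in> D \<Longrightarrow> \<exists>x\<in>D. R x = y"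
begin

text \<open>With \<open>R\<close> as the absolute value of \<open>G\<close>, this is the subspace on
  which \<open>G\<close> is positive.\<close>

definition part :: "'a set" where "part = {x \<in> D. G x = R x}"

lemma part_D: "x \<in> part \<Longrightarrow> x \<in> D" and part_eq: "x \<in> part \<Longrightarrow> G x = R x"
  by (auto simp: part_def)

lemma R_inj: assumes "x \<in> D" "R x = 0" shows "x = 0"
proof -
  have "d * (N x)\<^sup>2 \<le> 0" using R_pos[of x] assms by simp
  then show ?thesis using d assms by (simp add: mult_le_0_iff)
qed

text \<open>Surjectivity of \<open>R^2 = G^2\<close> gives \<open>x\<close> with
  \<open>G (G x) = p\<close>, so \<open>q = G x\<close> is a preimage. It lies in
  \<open>part\<close> because \<open>R\<close> sends both \<open>R q\<close> and \<open>G q\<close>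
  to \<open>G p = R p\<close> and is injective. Preimages matter since \<open>B\<close> is
  computable only through \<open>B (G q) y = ip q y\<close>.\<close>

lemma part_preimage:
  assumes p: "p \<in> part" obtains q where "q \<in> part" "G q = p"
proof -
  obtain y where y: "y \<in> D" "R y = p" using R_surj part_D[OF p] by blast
  obtain x where x: "x \<in> D" "R x = y" using R_surj y by blast
  have Gx: "G x \<in> D" "G (G x) = p" using R_R[OF x(1)] x y op_in[OF G(1)] by auto
  have "R (R (G x)) = R (G (G x))"
    using R_R[OF Gx(1)] part_eq[OF p] by (simp add: Gx)
  then have "R (R (G x) - G (G x)) = 0"
    using op_diff[OF R(1), of "R (G x)" "G (G x)"] Gx op_in[OF R(1)] part_D[OF p] by simp
  then have "R (G x) - G (G x) = 0"
    using R_inj[of "R (G x) - G (G x)"] Gx op_in[OF R(1)] part_D[OF p] by simp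
  then have "G x \<in> part" using Gx by (simp add: part_def)
  with Gx that show thesis by blast
qed

text \<open>For \<open>p = G q\<close> with \<open>q\<close> in \<open>part\<close>,
  \<open>B p p = ip q (G q) = ip q (R q)\<close>, which is at least \<open>d |q|^2\<close>, while
  \<open>|p| \<le> C |q|\<close>.\<close>

lemma part_lower: assumes p: "p \<in> part" shows "d / C\<^sup>2 * (N p)\<^sup>2 \<le> Re (B p p)"
proof -
  obtain q where q: "q \<in> part" "G q = p" using part_preimage[OF p] .
  note D = part_D[OF p] part_D[OF q(1)]
  have "B p p = ip q (R q)" using B_G[OF D(2,1)] q part_eq[OF q(1)] by simp
  also have "\<dots> = ip (R q) q" using R(2) D by (simp add: symmetric_op_def)
  finally have "d * (N q)\<^sup>2 \<le> Re (B p p)" using R_pos D by simp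
  moreover have "(N p)\<^sup>2 \<le> (C * N q)\<^sup>2"
    using op_bound[OF G(1) D(2)] q D by (intro power_mono) auto
  then have "d / C\<^sup>2 * (N p)\<^sup>2 \<le> d / C\<^sup>2 * (C * N q)\<^sup>2" using d by (intro mult_left_mono) auto
  then have "d / C\<^sup>2 * (N p)\<^sup>2 \<le> d * (N q)\<^sup>2" using C by (simp add: power_mult_distrib)
  ultimately show ?thesis by simp
qed

text \<open>On \<open>part\<close> the norm of \<open>B\<close> is equivalent to \<open>N\<close>:
  \<open>part_lower\<close> gives one estimate, \<open>B_bound\<close> the other. Completeness then
  passes to \<open>part\<close> because the kernel of \<open>G - R\<close> is closed.\<close>

lemma hilbert_part: "hilbert_on part B"
proof -
  have sub: "csubspace part"
    unfolding complex_vector.subspace_def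
    by (auto simp: part_def op_add[OF G(1)] op_add[OF R(1)] op_scale[OF G(1)] op_scale[OF R(1)]
        op_zero[OF G(1)] op_zero[OF R(1)])
  define e where "e = d / C\<^sup>2"
  have e: "0 < e" using d C by (simp add: e_def)
  have pos: "0 < Re (B p p)" if "p \<in> part" "p \<noteq> 0" for p
  proof -
    have "0 < e * (N p)\<^sup>2" using e part_D[OF that(1)] that by simp
    then show ?thesis using part_lower[OF that(1)] by (simp add: e_def)
  qed
  interpret P: inner_space part B
  proof
    show "inner_product_on part B"
      unfolding inner_product_on_def
    proof (intro conjI)
      show "sesquilinear_on part B" by (simp add: sesquilinear_on_def part_D)
      show "symmetric_form_on part B" using B_sym part_D unfolding symmetric_form_on_def by blast
    qed (use pos in blast)
  qed (rule sub)
  have lower: "N x \<le> P.N x / sqrt e" if x: "x \<in> part" for x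
  proof -
    have "sqrt (e * (N x)\<^sup>2) \<le> P.N x"
      unfolding induced_norm_def[of B] using part_lower[OF x] by (simp add: e_def)
    then show ?thesis using e part_D[OF x] by (simp add: real_sqrt_mult pos_le_divide_eq mult.commute)
  qed
  have upper: "P.N x \<le> sqrt b * N x" if x: "x \<in> part" for x
  proof -
    have "P.N x \<le> sqrt (b * (N x)\<^sup>2)"
      unfolding induced_norm_def[of B]
      using B_bound[of x x] part_D[OF x] complex_Re_le_cmod[of "B x x"]
      by (simp add: power2_eq_square mult.assoc)
    then show ?thesis using part_D[OF x] by (simp add: real_sqrt_mult)
  qed
  have "P.mcomplete"
    unfolding P.mcomplete_iff
  proof (intro allI impI)
    fix X assume X: "P.MCauchy X"
    then have XE: "X n \<in> part" for n by (simp add: P.MCauchy_iff)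
    note XD = part_D[OF XE]
    have "MCauchy X"
      unfolding MCauchy_iff
    proof (intro conjI allI impI XD)
      fix \<epsilon> :: real assume "0 < \<epsilon>"
      then have "0 < \<epsilon> * sqrt e" using e by simp
      then obtain M where M: "\<forall>m\<ge>M. \<forall>n\<ge>M. P.N (X m - X n) < \<epsilon> * sqrt e"
        using X unfolding P.MCauchy_iff by blast
      have "N (X m - X n) < \<epsilon>" if mn: "M \<le> m" "M \<le> n" for m n
      proof -
        have "P.N (X m - X n) / sqrt e < \<epsilon>" using M mn e by (simp add: pos_divide_less_eq)
        then show ?thesis using lower[OF P.diff_in[OF XE XE], of m n] by linarith
      qed
      then show "\<exists>M. \<forall>m\<ge>M. \<forall>n\<ge>M. N (X m - X n) < \<epsilon>" by blast
    qed
    then obtain x where x: "conv X x" using complete mcomplete_iff by blast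
    have "conv (\<lambda>n. G (X n)) (R x)" using conv_op[OF R(1) x] part_eq[OF XE] by simp
    then have "G x = R x" by (rule conv_unique[OF conv_op[OF G(1) x]])
    then have xE: "x \<in> part" using conv_in[OF x] by (simp add: part_def)
    have "P.conv X x"
    proof (rule P.convI)
      show "P.N (X n - x) \<le> sqrt b * N (X n - x)" for n using upper P.diff_in XE xE by blast
      show "(\<lambda>n. sqrt b * N (X n - x)) \<longlonglongrightarrow> 0"
        using x by (auto simp: conv_def intro: tendsto_mult_right_zero)
    qed (use XE xE in auto)
    then show "\<exists>x. P.conv X x" by blast
  qed
  then have "hilbert_space_on part B" by unfold_locales
  then show ?thesis by (simp add: hilbert_on_iff)
qed

lemma flip_signs: "square_root_splitting D ip (\<lambda>x y. - B x y) (\<lambda>x. - G x) R C C' b d"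
proof
  show "sesquilinear_on D (\<lambda>x y. - B x y)"
    using B.sesquilinear by (simp add: sesquilinear_on_def)
  show "symmetric_form_on D (\<lambda>x y. - B x y)"
    using B_sym unfolding symmetric_form_on_def complex_cnj_minus neg_equal_iff_equal .
  show "bounded_op (\<lambda>x. - G x) C"
    using G(1) by (simp add: bounded_op_def)
  show "symmetric_op (\<lambda>x. - G x)"
    using G op_in[OF G(1)] by (simp add: symmetric_op_def)
qed (use csub B_bound B_G R R_G R_R R_pos R_surj C d op_in[OF G(1)] op_in[OF R(1)] op_minus[OF G(1)]
    op_minus[OF R(1)] in auto)

lemma krein_decomposition: "\<exists>Dp Dm. krein_decomposition D B Dp Dm"
proof -
  interpret M: square_root_splitting D ip "\<lambda>x y. - B x y" "\<lambda>x. - G x" R C C' b d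
    by (rule flip_signs)
  have "krein_decomposition D B part M.part"
    unfolding krein_decomposition_def
  proof (intro conjI hilbert_part M.hilbert_part ballI)
    show "D = {p + m |p m. p \<in> part \<and> m \<in> M.part}"
    proof (intro equalityI subsetI)
      fix x assume "x \<in> D"
      \<comment> \<open>Writing \<open>x = R w\<close> avoids inverting \<open>R\<close>:
        \<open>R w + G w\<close> and \<open>R w - G w\<close> are annihilated by
        \<open>G - R\<close> and \<open>G + R\<close> respectively, since \<open>R\<close> and
        \<open>G\<close> commute and have equal squares.\<close>
      then obtain w where w: "w \<in> D" "R w = x" using R_surj by blast
      note [simp] = op_in[OF R(1)] op_in[OF G(1)] op_scale[OF R(1)] op_scale[OF G(1)]
        op_add[OF R(1)] op_add[OF G(1)] op_diff[OF R(1)] op_diff[OF G(1)]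
      have "(1/2) *\<^sub>C (R w + G w) \<in> part" "(1/2) *\<^sub>C (R w - G w) \<in> M.part"
        using w(1) by (auto simp: part_def M.part_def R_G R_R complex_vector.scale_right_distrib
            complex_vector.scale_right_diff_distrib)
      moreover have "(1/2) *\<^sub>C (R w + G w) + (1/2) *\<^sub>C (R w - G w) = (1/2 + 1/2) *\<^sub>C R w"
        unfolding complex_vector.scale_left_distrib
        by (simp add: complex_vector.scale_right_distrib complex_vector.scale_right_diff_distrib)
      then have "x = (1/2) *\<^sub>C (R w + G w) + (1/2) *\<^sub>C (R w - G w)" using w by simp
      ultimately show "x \<in> {p + m |p m. p \<in> part \<and> m \<in> M.part}" by blast
    qed (auto simp: part_D M.part_D)
    show "part \<inter> M.part = {0}"
    proof (intro equalityI subsetI)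
      fix x assume x: "x \<in> part \<inter> M.part"
      then have xD: "x \<in> D" and "G x = R x" "- G x = R x"
        using part_eq M.part_eq part_D by blast+
      then have Rx: "R x = - R x" by metis
      have "2 *\<^sub>R R x = R x + - R x"
        unfolding scaleR_2 by (rule arg_cong2[where f = "(+)"]) (rule refl, rule Rx)
      then have "R x = 0" by simp
      then show "x \<in> {0}" using R_inj xD by simp
    qed (simp add: part_def M.part_def op_zero[OF G(1)] op_zero[OF R(1)])
    show "B p m = 0" if p: "p \<in> part" and m: "m \<in> M.part" for p m
    proof -
      obtain q where q: "q \<in> part" "G q = p" using part_preimage[OF p] .
      obtain w where w: "w \<in> M.part" "- G w = m" using M.part_preimage[OF m] .
      note D = part_D[OF q(1)] M.part_D[OF w(1)] M.part_D[OF m]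
      \<comment> \<open>Here \<open>B p m = ip q m\<close>. Moving \<open>G\<close> to
        \<open>q\<close>, replacing it by \<open>R\<close>, and moving \<open>R\<close> back to
        \<open>w\<close> turns \<open>ip q (G w)\<close> into \<open>ip q m\<close>, so
        \<open>ip q m\<close> equals its own negative.\<close>
      have "ip q m = - ip q (G w)"
        unfolding w(2)[symmetric] by (rule minus_right[OF D(1) op_in[OF G(1) D(2)]])
      also have "ip q (G w) = ip (G q) w" using G(2) D by (simp add: symmetric_op_def)
      also have "\<dots> = ip (R q) w" by (simp only: part_eq[OF q(1)])
      also have "\<dots> = ip q (R w)" using R(2) D by (simp add: symmetric_op_def)
      also have "R w = m" using M.part_eq[OF w(1)] w(2) by metis
      finally have "ip q m = 0" by simp
      then show ?thesis using B_G[of q m] q D by simp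
    qed
  qed
  then show ?thesis by blast
qed

end

section \<open>The Hilbert space of a Krein decomposition\<close>

locale krein_decomposed = sesquilinear_form D B
  for D :: "'a::complex_vector set" and B :: "'a \<Rightarrow> 'a \<Rightarrow> complex" +
  fixes Dp Dm :: "'a set"
  assumes symmetric: "symmetric_form_on D B" and decomposition: "krein_decomposition D B Dp Dm"
begin

sublocale pos: hilbert_space_on Dp B
  using decomposition by (simp add: krein_decomposition_def hilbert_on_iff)

sublocale neg: hilbert_space_on Dm "\<lambda>x y. - B x y"
  using decomposition by (simp add: krein_decomposition_def hilbert_on_iff)

lemma D_eq: "D = {p + m |p m. p \<in> Dp \<and> m \<in> Dm}" and disjoint: "Dp \<inter> Dm = {0}"
  and orthogonal: "p \<in> Dp \<Longrightarrow> m \<in> Dm \<Longrightarrow> B p m = 0"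
  using decomposition unfolding krein_decomposition_def by blast+

lemma sum_in: "p \<in> Dp \<Longrightarrow> m \<in> Dm \<Longrightarrow> p + m \<in> D"
  unfolding D_eq by blast

lemma pos_in: "p \<in> Dp \<Longrightarrow> p \<in> D"
  using sum_in[of p 0] by simp

lemma neg_in: "m \<in> Dm \<Longrightarrow> m \<in> D"
  using sum_in[of 0 m] by simp

lemma orthogonal': assumes "p \<in> Dp" "m \<in> Dm" shows "B m p = 0"
proof -
  have "B m p = cnj (B p m)"
    using symmetric pos_in neg_in assms unfolding symmetric_form_on_def by blast
  then show ?thesis using orthogonal assms by simp
qed

lemma component_pos: assumes "p \<in> Dp" "m \<in> Dm" shows "component Dp Dm (p + m) = p"
  unfolding component_def
proof (rule the_equality)
  show "p \<in> Dp \<and> p + m - p \<in> Dm" using assms by simp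
  fix u assume u: "u \<in> Dp \<and> p + m - u \<in> Dm"
  have "(p + m - u) - m \<in> Dm" using neg.diff_in u assms by blast
  then have "p - u \<in> Dp \<inter> Dm" using u assms by (simp add: algebra_simps)
  then show "u = p" using disjoint by simp
qed

lemma component_neg: assumes "p \<in> Dp" "m \<in> Dm" shows "component Dm Dp (p + m) = m"
  unfolding component_def
proof (rule the_equality)
  show "m \<in> Dm \<and> p + m - m \<in> Dp" using assms by simp
  fix u assume u: "u \<in> Dm \<and> p + m - u \<in> Dp"
  have "(p + m - u) - p \<in> Dp" using pos.diff_in u assms by blast
  then have "m - u \<in> Dp \<inter> Dm" using u assms by (simp add: algebra_simps)
  then show "u = m" using disjoint by simp
qed

lemma decompose:
  assumes "x \<in> D" obtains p m where "p \<in> Dp" "m \<in> Dm" "x = p + m"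
  using assms unfolding D_eq by blast

abbreviation "K \<equiv> krein_inner B Dp Dm"

text \<open>The fundamental symmetry of the decomposition: an involution, isometric for
  \<open>K\<close>, which exchanges \<open>B\<close> and \<open>K\<close> when inserted in either
  argument.\<close>

definition J :: "'a \<Rightarrow> 'a" where "J x = component Dp Dm x - component Dm Dp x"

context
  fixes p m p' m' :: 'a
  assumes in_parts: "p \<in> Dp" "m \<in> Dm" "p' \<in> Dp" "m' \<in> Dm"
begin

lemma K_sum: "K (p + m) (p' + m') = B p p' - B m m'"
  using in_parts by (simp add: krein_inner_def component_pos component_neg)

lemma B_sum: "B (p + m) (p' + m') = B p p' + B m m'"
  using in_parts by (simp add: pos_in neg_in orthogonal orthogonal')

lemma J_sum: "J (p + m) = p + - m"
  using in_parts by (simp add: J_def component_pos component_neg)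

end

lemma K_sesquilinear: "sesquilinear_on D K"
  unfolding sesquilinear_on_def
proof (intro conjI ballI allI)
  fix x y z assume "x \<in> D" "y \<in> D" "z \<in> D"
  then obtain p m p' m' q n where *: "p \<in> Dp" "m \<in> Dm" "x = p + m" "p' \<in> Dp" "m' \<in> Dm" "y = p' + m'"
    "q \<in> Dp" "n \<in> Dm" "z = q + n" by (metis decompose)
  have "x + y = (p + p') + (m + m')" using * by simp
  then show "K (x + y) z = K x z + K y z"
    using * by (simp only: K_sum pos.add_in neg.add_in pos.add_left)
      (use * in \<open>simp add: pos_in neg_in\<close>)
  have "y + z = (p' + q) + (m' + n)" using * by simp
  then show "K x (y + z) = K x y + K x z"
    using * by (simp only: K_sum pos.add_in neg.add_in)
      (use * in \<open>simp add: pos_in neg_in\<close>)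
next
  fix a x y assume "x \<in> D" "y \<in> D"
  then obtain p m p' m' where *: "p \<in> Dp" "m \<in> Dm" "x = p + m" "p' \<in> Dp" "m' \<in> Dm" "y = p' + m'"
    by (metis decompose)
  have "a *\<^sub>C x = a *\<^sub>C p + a *\<^sub>C m" using * by (simp add: complex_vector.scale_right_distrib)
  then show "K (a *\<^sub>C x) y = a * K x y"
    using * by (simp only: K_sum pos.scale_in neg.scale_in)
      (use * in \<open>simp add: pos_in neg_in right_diff_distrib\<close>)
  have "a *\<^sub>C y = a *\<^sub>C p' + a *\<^sub>C m'" using * by (simp add: complex_vector.scale_right_distrib)
  then show "K x (a *\<^sub>C y) = cnj a * K x y"
    using * by (simp only: K_sum pos.scale_in neg.scale_in)
      (use * in \<open>simp add: pos_in neg_in right_diff_distrib\<close>)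
qed

lemma K_self: "p \<in> Dp \<Longrightarrow> m \<in> Dm \<Longrightarrow> Re (K (p + m) (p + m)) = (pos.N p)\<^sup>2 + (neg.N m)\<^sup>2"
  by (simp only: K_sum pos.norm_sq neg.norm_sq) simp

lemma K_inner_product: "inner_product_on D K"
  unfolding inner_product_on_def
proof (intro conjI K_sesquilinear ballI impI)
  show "symmetric_form_on D K"
    unfolding symmetric_form_on_def
  proof (intro ballI)
    fix x y assume "x \<in> D" "y \<in> D"
    then obtain p m p' m' where *: "p \<in> Dp" "m \<in> Dm" "x = p + m" "p' \<in> Dp" "m' \<in> Dm" "y = p' + m'"
      by (metis decompose)
    have "B p p' = cnj (B p' p)" "B m m' = cnj (B m' m)"
      using symmetric * pos_in neg_in unfolding symmetric_form_on_def by blast+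
    then show "K x y = cnj (K y x)" unfolding *(3,6) K_sum[OF *(1,2,4,5)] K_sum[OF *(4,5,1,2)]
      by (simp only: complex_cnj_diff)
  qed
  fix x assume x: "x \<in> D" "x \<noteq> 0"
  then obtain p m where *: "p \<in> Dp" "m \<in> Dm" "x = p + m" by (metis decompose)
  then have "p \<noteq> 0 \<or> m \<noteq> 0" using x by auto
  then have "0 < (pos.N p)\<^sup>2 + (neg.N m)\<^sup>2"
    using * by (auto simp: add_pos_nonneg add_nonneg_pos)
  then show "0 < Re (K x x)" using K_self * by simp
qed

text \<open>By the Pythagorean identity \<open>sq\<close> the norm of a sum controls and is
  controlled by the norms of its two components, so Cauchy sequences and limits can be treated
  componentwise.\<close>

lemma K_hilbert: "hilbert_space_on D K"
proof -
  interpret K: inner_space D K by unfold_locales (rule subspace, rule K_inner_product)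
  have sq: "(K.N (p + m))\<^sup>2 = (pos.N p)\<^sup>2 + (neg.N m)\<^sup>2" if "p \<in> Dp" "m \<in> Dm" for p m
    using K.norm_sq[OF sum_in] K_self that by simp
  have le_pos: "pos.N p \<le> K.N (p + m)" and le_neg: "neg.N m \<le> K.N (p + m)"
    and le_sum: "K.N (p + m) \<le> pos.N p + neg.N m" if pm: "p \<in> Dp" "m \<in> Dm" for p m
  proof -
    note N = pos.norm_nonneg[OF pm(1)] neg.norm_nonneg[OF pm(2)] K.norm_nonneg[OF sum_in[OF pm]]
    show "pos.N p \<le> K.N (p + m)" "neg.N m \<le> K.N (p + m)"
      by (rule power2_le_imp_le; simp add: sq pm N)+
    show "K.N (p + m) \<le> pos.N p + neg.N m"
      by (rule power2_le_imp_le) (simp_all add: sq pm N power2_sum)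
  qed
  have "K.mcomplete"
    unfolding K.mcomplete_iff
  proof (intro allI impI)
    fix X assume X: "K.MCauchy X"
    then have "X n \<in> D" for n by (simp add: K.MCauchy_iff)
    then have "\<forall>n. \<exists>p m. p \<in> Dp \<and> m \<in> Dm \<and> X n = p + m" by (metis decompose)
    then obtain p m where pm: "\<And>n. p n \<in> Dp" "\<And>n. m n \<in> Dm" "\<And>n. X n = p n + m n" by metis
    have diff: "X j - X k = (p j - p k) + (m j - m k)" for j k by (simp add: pm)
    have Cauchy: "\<exists>M. \<forall>j\<ge>M. \<forall>k\<ge>M. K.N (X j - X k) < e" if "0 < e" for e
      using X that by (simp add: K.MCauchy_iff)
    have "pos.N (p j - p k) \<le> K.N (X j - X k)" "neg.N (m j - m k) \<le> K.N (X j - X k)" for j k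
      unfolding diff by (rule le_pos le_neg; simp add: pm)+
    then have "pos.MCauchy p" "neg.MCauchy m"
      unfolding pos.MCauchy_iff neg.MCauchy_iff using Cauchy pm by (meson order.strict_trans1)+
    then obtain a b where a: "pos.conv p a" and b: "neg.conv m b"
      using pos.complete neg.complete unfolding pos.mcomplete_iff neg.mcomplete_iff by blast
    note in_parts = pos.conv_in[OF a] neg.conv_in[OF b]
    have "K.conv X (a + b)"
    proof (rule K.convI)
      show "X n \<in> D" for n using pm sum_in by simp
      show "a + b \<in> D" using in_parts sum_in by simp
      show "K.N (X n - (a + b)) \<le> pos.N (p n - a) + neg.N (m n - b)" for n
        using le_sum[of "p n - a" "m n - b"] in_parts pm by (simp add: algebra_simps)
      show "(\<lambda>n. pos.N (p n - a) + neg.N (m n - b)) \<longlonglongrightarrow> 0"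
        using a b unfolding pos.conv_def neg.conv_def by (intro tendsto_add_zero) auto
    qed
    then show "\<exists>x. K.conv X x" by blast
  qed
  then show ?thesis by unfold_locales
qed

sublocale K: hilbert_space_on D K
  by (rule K_hilbert)

lemma J_in: "x \<in> D \<Longrightarrow> J x \<in> D"
  by (erule decompose) (simp add: J_sum sum_in pos_in neg_in)

lemma J_J: assumes "x \<in> D" shows "J (J x) = x"
proof -
  obtain p m where pm: "p \<in> Dp" "m \<in> Dm" "x = p + m" using decompose[OF assms] .
  have "J (p + - m) = p + - (- m)" using pm by (intro J_sum) auto
  then show ?thesis using pm J_sum by simp
qed

lemma K_J: assumes "x \<in> D" "y \<in> D" shows "K x (J y) = B x y" "K (J x) y = B x y"
proof -
  obtain p m p' m' where *: "p \<in> Dp" "m \<in> Dm" "x = p + m" "p' \<in> Dp" "m' \<in> Dm" "y = p' + m'"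
    using assms by (metis decompose)
  have "K (p + m) (p' + - m') = B p p' - B m (- m')" "K (p + - m) (p' + m') = B p p' - B (- m) m'"
    using * by (intro K_sum; simp)+
  moreover have "J x = p + - m" "J y = p' + - m'" using * J_sum by simp_all
  moreover have "B x y = B p p' + B m m'" unfolding *(3,6) by (rule B_sum) fact+
  ultimately show "K x (J y) = B x y" "K (J x) y = B x y"
    using * neg_in by simp_all
qed

lemma norm_J: assumes "x \<in> D" shows "K.N (J x) = K.N x"
proof -
  have "K (J x) (J x) = K x x"
    using K_J[of "J x" x] K_J[of x "J x"] J_J J_in assms by simp
  then show ?thesis by (simp add: induced_norm_def)
qed

lemma B_bound: assumes "x \<in> D" "y \<in> D" shows "cmod (B x y) \<le> K.N x * K.N y"
  using K.Cauchy_Schwarz[OF assms(1) J_in[OF assms(2)]] assms by (simp add: K_J norm_J)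

end

text \<open>Continuity of a linear map at 0 gives a bound by rescaling. This trades the topological
  embedding condition for the estimate that q-closedness asks for.\<close>

lemma embedding_continuous_iff:
  fixes D :: "'a::complex_inner set"
  assumes "inner_space D ip"
  shows "continuous_map (Metric_space.mtopology D (norm_dist D (induced_norm ip))) euclidean (\<lambda>x. x)
    \<longleftrightarrow> (\<exists>\<alpha>>0. \<forall>x\<in>D. norm x \<le> \<alpha> * induced_norm ip x)" (is "?cont \<longleftrightarrow> ?bdd")
proof
  interpret inner_space D ip by fact
  have norm_scaleC: "norm (of_real a *\<^sub>C x) = \<bar>a\<bar> * norm x" for a and x :: 'a
    by (simp flip: scaleR_scaleC)
  assume ?cont
  then have "openin mtopology {x \<in> topspace mtopology. x \<in> ball 0 1}"
    by (rule openin_continuous_map_preimage) simp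
  moreover have "0 \<in> {x \<in> topspace mtopology. x \<in> ball (0::'a) 1}" by simp
  ultimately obtain r where r: "0 < r" "mball 0 r \<subseteq> {x \<in> topspace mtopology. x \<in> ball (0::'a) 1}"
    unfolding openin_mtopology by blast
  have "norm x \<le> 2 / r * N x" if x: "x \<in> D" for x
  proof (rule homogeneous_bound[of norm, OF _ _ x])
    show "norm x \<le> 2 / r" if x: "x \<in> D" "N x \<le> 1" for x
    proof -
      \<comment> \<open>Half the radius, since \<open>mball\<close> is open and
        \<open>N x = 1\<close> is allowed; hence the bound \<open>2 / r\<close>.\<close>
      have "N (of_real (r / 2) *\<^sub>C x) \<le> r / 2 * 1"
        unfolding norm_scale[OF x(1)] norm_of_real using r x by (intro mult_mono) auto
      then have "of_real (r / 2) *\<^sub>C x \<in> mball 0 r"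
        using x r norm_minus[of "of_real (r / 2) *\<^sub>C x"]
        by (simp add: norm_dist_def del: norm_scale norm_minus)
      then have "norm (of_real (r / 2) *\<^sub>C x) < 1" using r by auto
      then show ?thesis using r unfolding norm_scaleC by (simp add: field_simps)
    qed
  qed (simp add: norm_scaleC)
  then show ?bdd using r by (intro exI[of _ "2 / r"]) auto
next
  interpret inner_space D ip by fact
  assume ?bdd
  then obtain \<alpha> where \<alpha>: "0 < \<alpha>" "\<And>x. x \<in> D \<Longrightarrow> norm x \<le> \<alpha> * N x" by blast
  show ?cont
    unfolding continuous_map_def
  proof (intro conjI allI impI)
    fix U :: "'a set" assume "openin euclidean U"
    then have U: "open U" by simp
    show "openin mtopology {x \<in> topspace mtopology. x \<in> U}"
      unfolding openin_mtopology
    proof (intro conjI allI impI)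
      fix x assume "x \<in> {x \<in> topspace mtopology. x \<in> U}"
      then have x: "x \<in> D" "x \<in> U" by auto
      then obtain e where e: "0 < e" "ball x e \<subseteq> U" using U openE by blast
      have "y \<in> U" if "y \<in> D" "N (x - y) < e / \<alpha>" for y
      proof -
        have "norm (x - y) < e"
          using \<alpha>(2)[of "x - y"] that x \<alpha>(1) by (simp add: pos_less_divide_eq mult.commute)
        then show ?thesis using e by (auto simp: dist_norm)
      qed
      then have "mball x (e / \<alpha>) \<subseteq> {x \<in> topspace mtopology. x \<in> U}"
        by (auto simp: norm_dist_def)
      then show "\<exists>r>0. mball x r \<subseteq> {x \<in> topspace mtopology. x \<in> U}"
        using e \<alpha> by (intro exI[of _ "e / \<alpha>"]) auto
    qed auto
  qed simp
qed

section \<open>Solvable forms and Krein spaces\<close>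

text \<open>The choice operator reveals only that some decomposition induces the topology, not which
  one. Norm comparisons for this topology must therefore hold for an arbitrary
  decomposition.\<close>

lemma krein_topology_eq:
  assumes "krein_space D B"
  obtains Dp Dm where "krein_decomposition D B Dp Dm"
    "krein_topology D B = Metric_space.mtopology D (norm_dist D (induced_norm (krein_inner B Dp Dm)))"
proof -
  have "\<exists>T Dp Dm. krein_decomposition D B Dp Dm \<and>
     T = Metric_space.mtopology D (norm_dist D (induced_norm (krein_inner B Dp Dm)))"
    using assms unfolding krein_space_def by blast
  from someI_ex[OF this] show thesis using that unfolding krein_topology_def by blast
qed

context hilbert_space_on
begin

text \<open>The hypothesis \<open>B_ex\<close> provides a Gram operator \<open>G\<close> of \<open>ip\<close> with respect to \<open>B\<close>, which is
  bounded by the Hellinger-Toeplitz theorem; the sign decomposition of \<open>G\<close> is a Krein decomposition.\<close>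

lemma gram_operator:
  assumes B: "sesquilinear_on D B" "symmetric_form_on D B"
    and b: "0 < b" "\<And>x y. x \<in> D \<Longrightarrow> y \<in> D \<Longrightarrow> cmod (B x y) \<le> b * N x * N y"
    and nondegenerate: "\<And>x. x \<in> D \<Longrightarrow> (\<And>y. y \<in> D \<Longrightarrow> B x y = 0) \<Longrightarrow> x = 0"
    and B_ex: "\<And>z. z \<in> D \<Longrightarrow> \<exists>x\<in>D. \<forall>y\<in>D. B x y = ip z y"
  obtains C G where "0 < C" "bounded_op G C" "symmetric_op G"
    "\<And>x y. x \<in> D \<Longrightarrow> y \<in> D \<Longrightarrow> B (G x) y = ip x y"
    "\<And>x. x \<in> D \<Longrightarrow> N x \<le> b * N (G x)"
proof -
  interpret B: sesquilinear_form D B by unfold_locales (rule csub, rule B)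
  obtain G where GD [simp]: "\<And>z. z \<in> D \<Longrightarrow> G z \<in> D"
    and G: "\<And>x y. x \<in> D \<Longrightarrow> y \<in> D \<Longrightarrow> B (G x) y = ip x y"
    using B_ex by metis
  \<comment> \<open>Nondegeneracy makes the solution of \<open>B u y = ip z y\<close> unique, which
    is where the linearity of the chosen \<open>G\<close> comes from.\<close>
  have eqI: "u = v" if "u \<in> D" "v \<in> D" "\<And>y. y \<in> D \<Longrightarrow> B u y = B v y" for u v
    using nondegenerate[of "u - v"] that by simp
  have sym: "symmetric_op G"
    unfolding symmetric_op_def
  proof (intro ballI)
    fix x y assume xy: "x \<in> D" "y \<in> D"
    have "ip x (G y) = B (G x) (G y)" using G xy by simp
    also have "\<dots> = cnj (B (G y) (G x))"
      using B(2) xy GD unfolding symmetric_form_on_def by blast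
    also have "\<dots> = ip (G x) y" using G[of y "G x"] ip_commute[of "G x" y] xy by simp
    finally show "ip (G x) y = ip x (G y)" by simp
  qed
  obtain C where C: "0 < C" "bounded_op G C"
  proof (rule Hellinger_Toeplitz[of G])
    show "G (x + y) = G x + G y" if "x \<in> D" "y \<in> D" for x y
      by (rule eqI) (use that in \<open>simp_all add: G\<close>)
    show "G (a *\<^sub>C x) = a *\<^sub>C G x" if "x \<in> D" for a x
      by (rule eqI) (use that in \<open>simp_all add: G\<close>)
  qed (use sym in auto)
  have "N x \<le> b * N (G x)" if x: "x \<in> D" for x
  proof (cases "x = 0")
    case False
    then have pos: "0 < N x" using x norm_nonneg[of x] norm_eq_0[of x] by linarith
    have "N x * N x = cmod (B (G x) x)"
      using x by (simp add: G ip_self norm_power power2_eq_square norm_mult)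
    also have "\<dots> \<le> b * N (G x) * N x" using b x by simp
    finally show ?thesis using pos by simp
  qed (use b in simp)
  with that[OF C sym G] show thesis by blast
qed

lemma krein_decomposition_exists:
  assumes B: "sesquilinear_on D B" "symmetric_form_on D B"
    and b: "0 < b" "\<And>x y. x \<in> D \<Longrightarrow> y \<in> D \<Longrightarrow> cmod (B x y) \<le> b * N x * N y"
    and G: "0 < C" "bounded_op G C" "symmetric_op G"
      "\<And>x y. x \<in> D \<Longrightarrow> y \<in> D \<Longrightarrow> B (G x) y = ip x y" "\<And>x. x \<in> D \<Longrightarrow> N x \<le> b * N (G x)"
  shows "\<exists>Dp Dm. krein_decomposition D B Dp Dm"
proof -
  \<comment> \<open>The square root lemma asks that the lower bound, here \<open>1 / b\<close>, not
    exceed the upper bound of \<open>G\<close>; enlarging the upper bound is harmless.\<close>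
  define C' where "C' = max C (1 / b)"
  have C': "0 < C'" "C \<le> C'" "1 / b \<le> C'" using G by (simp_all add: C'_def)
  have "N (G x) \<le> C' * N x" if "x \<in> D" for x
    using op_bound[OF G(2) that] mult_right_mono[OF C'(2) norm_nonneg[OF that]] by linarith
  then have G': "bounded_op G C'" using G(2) unfolding bounded_op_def by blast
  obtain R K d where R: "bounded_op R K" "symmetric_op R" "0 < d"
    "\<And>x. x \<in> D \<Longrightarrow> R (G x) = G (R x)" "\<And>x. x \<in> D \<Longrightarrow> R (R x) = G (G x)"
    "\<And>x. x \<in> D \<Longrightarrow> d * (N x)\<^sup>2 \<le> Re (ip (R x) x)" "\<And>y. y \<in> D \<Longrightarrow> \<exists>x\<in>D. R x = y"
  proof (rule bounded_below_symmetric_sqrt[OF G' G(3), of "1 / b"])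
    show "1 / b * N x \<le> N (G x)" if "x \<in> D" for x
      using G(5)[OF that] b by (simp add: pos_divide_le_eq mult.commute)
  qed (use b C' in auto)
  interpret square_root_splitting D ip B G R C' K b d
    by unfold_locales (fact csub B b G' G C' R)+
  show ?thesis by (rule krein_decomposition)
qed

text \<open>By uniform boundedness the norm of any Krein decomposition is dominated by \<open>N\<close>, so \<open>B\<close> is
  bounded on the product of the two spaces; now \<open>N x ^ 2 = B (G x) x\<close>.\<close>

lemma norm_le_krein_norm:
  assumes B: "symmetric_form_on D B" "sesquilinear_on D B"
    and b: "0 < b" "\<And>x y. x \<in> D \<Longrightarrow> y \<in> D \<Longrightarrow> cmod (B x y) \<le> b * N x * N y"
    and G: "0 < C" "bounded_op G C" "\<And>x y. x \<in> D \<Longrightarrow> y \<in> D \<Longrightarrow> B (G x) y = ip x y"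
    and dec: "krein_decomposition D B Dp Dm"
  obtains c where "0 < c" "\<And>x. x \<in> D \<Longrightarrow> N x \<le> c * induced_norm (krein_inner B Dp Dm) x"
proof -
  interpret K: krein_decomposed D B Dp Dm
    by unfold_locales (fact csub B dec)+
  \<comment> \<open>Pairing with \<open>J z\<close> under the Krein inner product is
    \<open>B x z\<close>, so the boundedness of \<open>B\<close> in \<open>N\<close> makes this set
    pointwise bounded.\<close>
  let ?V = "{K.J z |z. z \<in> D \<and> N z \<le> 1}"
  obtain c where c: "0 < c" "\<And>v. v \<in> ?V \<Longrightarrow> K.K.N v \<le> c"
  proof (rule K.K.uniform_boundedness)
    show "?V \<subseteq> D" using K.J_in by blast
    show "\<exists>M. \<forall>v\<in>?V. cmod (K.K x v) \<le> M" if x: "x \<in> D" for x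
    proof (intro exI ballI)
      fix v assume "v \<in> ?V"
      then obtain z where z: "z \<in> D" "N z \<le> 1" "v = K.J z" by blast
      have "cmod (K.K x v) = cmod (B x z)" using K.K_J x z by simp
      also have "\<dots> \<le> b * N x * N z" using b(2) x z by simp
      also have "\<dots> \<le> b * N x * 1" using b(1) x z by (intro mult_left_mono) auto
      finally show "cmod (K.K x v) \<le> b * N x * 1" .
    qed
  qed blast
  have le: "K.K.N z \<le> c * N z" if "z \<in> D" for z
  proof (rule homogeneous_bound[OF _ _ that])
    show "K.K.N x \<le> c" if "x \<in> D" "N x \<le> 1" for x
      using c(2)[of "K.J x"] K.norm_J that by auto
  qed simp
  have "N x \<le> c * C * K.K.N x" if x: "x \<in> D" for x
  proof (cases "x = 0")
    case False
    then have pos: "0 < N x" using x norm_nonneg[of x] norm_eq_0[of x] by linarith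
    have "N x * N x = cmod (B (G x) x)"
      using x by (simp add: G ip_self norm_power power2_eq_square norm_mult)
    also have "\<dots> \<le> K.K.N (G x) * K.K.N x" using K.B_bound x op_in[OF G(2)] by simp
    also have "\<dots> \<le> c * (C * N x) * K.K.N x"
    proof (intro mult_right_mono)
      have "K.K.N (G x) \<le> c * N (G x)" using le op_in[OF G(2)] x by simp
      also have "\<dots> \<le> c * (C * N x)" using c op_bound[OF G(2) x] by (intro mult_left_mono) auto
      finally show "K.K.N (G x) \<le> c * (C * N x)" .
    qed (use x in simp)
    finally have "N x * N x \<le> (c * C * K.K.N x) * N x" by (simp add: mult_ac)
    then show ?thesis using pos by simp
  qed simp
  moreover have "0 < c * C" using c G by simp
  ultimately show thesis by (rule that[rotated])
qed

end

text \<open>\<open>M\<close> is general so that both directions can use it: with the norm of the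
  given inner product and with that of a Krein decomposition.\<close>

lemma bounded_form_le:
  assumes \<Upsilon>: "bounded_form \<Upsilon>" and \<alpha>: "0 < \<alpha>" "\<And>x. x \<in> D \<Longrightarrow> norm x \<le> \<alpha> * M x"
  obtains k where "0 \<le> k" "\<And>x y. x \<in> D \<Longrightarrow> y \<in> D \<Longrightarrow> cmod (\<Upsilon> x y) \<le> k * M x * M y"
proof -
  obtain c where c: "\<And>x y. cmod (\<Upsilon> x y) \<le> c * norm x * norm y"
    using \<Upsilon> unfolding bounded_form_def by blast
  have "cmod (\<Upsilon> x y) \<le> \<bar>c\<bar> * \<alpha>\<^sup>2 * M x * M y" if xy: "x \<in> D" "y \<in> D" for x y
  proof -
    have "c * (norm x * norm y) \<le> \<bar>c\<bar> * (norm x * norm y)"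
      by (intro mult_right_mono) auto
    then have "cmod (\<Upsilon> x y) \<le> \<bar>c\<bar> * (norm x * norm y)"
      using c[of x y] by (simp add: mult.assoc)
    also have "\<dots> \<le> \<bar>c\<bar> * ((\<alpha> * M x) * (\<alpha> * M y))"
      using order_trans[OF norm_ge_zero \<alpha>(2)[OF xy(1)]] \<alpha>(2) xy
      by (intro mult_left_mono mult_mono) auto
    finally show ?thesis by (simp add: power2_eq_square mult_ac)
  qed
  then show thesis using that[of "\<bar>c\<bar> * \<alpha>\<^sup>2"] by simp
qed

lemma krein_of_solvable:
  fixes D :: "'h::complex_inner set"
  assumes D: "csubspace D" and \<Omega>: "sesquilinear_on D \<Omega>" and \<Upsilon>: "bounded_form \<Upsilon>"
    and sym: "symmetric_form_on D (form_add \<Omega> \<Upsilon>)"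
    and ip: "inner_product_on D ip" and q: "q_closed D \<Omega> (induced_norm ip)"
    and solving: "\<Upsilon> \<in> solving_forms D \<Omega> (induced_norm ip)"
  shows "krein_space D (form_add \<Omega> \<Upsilon>) \<and> continuously_embedded_krein D (form_add \<Omega> \<Upsilon>)"
proof -
  define B where "B = form_add \<Omega> \<Upsilon>"
  interpret hilbert_space_on D ip
    using D ip q unfolding q_closed_def reflexive_banach_on_def hilbert_on_iff[symmetric] hilbert_on_def
    by blast
  have B: "sesquilinear_on D B" "symmetric_form_on D B"
    using \<Omega> \<Upsilon> sym unfolding B_def bounded_form_def sesquilinear_on_def form_add_def
    by (simp_all add: algebra_simps)
  obtain \<alpha> \<beta> where \<alpha>: "0 < \<alpha>" "\<And>x. x \<in> D \<Longrightarrow> norm x \<le> \<alpha> * N x"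
    and \<beta>: "0 < \<beta>" "\<And>x y. x \<in> D \<Longrightarrow> y \<in> D \<Longrightarrow> cmod (\<Omega> x y) \<le> \<beta> * N x * N y"
    using q unfolding q_closed_def by blast
  obtain k where k: "0 \<le> k" "\<And>x y. x \<in> D \<Longrightarrow> y \<in> D \<Longrightarrow> cmod (\<Upsilon> x y) \<le> k * N x * N y"
    using bounded_form_le[OF \<Upsilon> \<alpha>] by blast
  define b where "b = \<beta> + k"
  have b: "0 < b" using \<beta> k by (simp add: b_def)
  have B_bound: "cmod (B x y) \<le> b * N x * N y" if xy: "x \<in> D" "y \<in> D" for x y
    using norm_triangle_ineq[of "\<Omega> x y" "\<Upsilon> x y"] \<beta>(2)[OF xy] k(2)[OF xy]
    by (simp add: B_def form_add_def b_def algebra_simps)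
  have B_ex: "\<exists>x\<in>D. \<forall>y\<in>D. B x y = ip z y" if z: "z \<in> D" for z
  proof -
    \<comment> \<open>Members of \<open>conj_dual_on\<close> vanish outside \<open>D\<close>, hence
      the cut-off. Solving for this functional yields the value of the Gram operator at
      \<open>z\<close>.\<close>
    have "(\<lambda>y. if y \<in> D then ip z y else 0) \<in> conj_dual_on D N"
      unfolding conj_dual_on_def using Cauchy_Schwarz[OF z] z by auto
    then show ?thesis using solving unfolding solving_forms_def B_def by force
  qed
  have nondegenerate: "x = 0" if "x \<in> D" "\<And>y. y \<in> D \<Longrightarrow> B x y = 0" for x
    using solving that unfolding solving_forms_def B_def by blast
  obtain C G where G: "0 < C" "bounded_op G C" "symmetric_op G"
    "\<And>x y. x \<in> D \<Longrightarrow> y \<in> D \<Longrightarrow> B (G x) y = ip x y" "\<And>x. x \<in> D \<Longrightarrow> N x \<le> b * N (G x)"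
    using B b B_bound nondegenerate B_ex that by (rule gram_operator)
  have krein: "krein_space D B"
    unfolding krein_space_def
    using D B krein_decomposition_exists[OF B b B_bound G] by blast
  obtain Dp Dm where dec: "krein_decomposition D B Dp Dm"
    and top: "krein_topology D B
      = Metric_space.mtopology D (norm_dist D (induced_norm (krein_inner B Dp Dm)))"
    using krein_topology_eq[OF krein] .
  interpret K: krein_decomposed D B Dp Dm
    by unfold_locales (fact csub B dec)+
  obtain c where c: "0 < c" "\<And>x. x \<in> D \<Longrightarrow> N x \<le> c * K.K.N x"
    using norm_le_krein_norm[OF B(2,1) b B_bound G(1,2,4) dec] by blast
  have "norm x \<le> (\<alpha> * c) * K.K.N x" if "x \<in> D" for x
    using \<alpha>(2)[OF that] mult_left_mono[OF c(2)[OF that] less_imp_le[OF \<alpha>(1)]]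
    unfolding mult.assoc by (rule order_trans)
  then have "continuously_embedded_krein D B"
    unfolding continuously_embedded_krein_def top embedding_continuous_iff[OF K.K.inner_space_axioms]
    using \<alpha> c by (intro exI[of _ "\<alpha> * c"]) auto
  with krein show ?thesis by (simp add: B_def)
qed

lemma solvable_of_krein:
  fixes D :: "'h::complex_inner set"
  assumes \<Upsilon>: "bounded_form \<Upsilon>" and krein: "krein_space D (form_add \<Omega> \<Upsilon>)"
    and cont: "continuously_embedded_krein D (form_add \<Omega> \<Upsilon>)"
  obtains ip where "inner_product_on D ip" "q_closed D \<Omega> (induced_norm ip)"
    "\<Upsilon> \<in> solving_forms D \<Omega> (induced_norm ip)"
proof -
  define B where "B = form_add \<Omega> \<Upsilon>"
  have B: "csubspace D" "sesquilinear_on D B" "symmetric_form_on D B"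
    using krein unfolding krein_space_def B_def by blast+
  obtain Dp Dm where dec: "krein_decomposition D B Dp Dm"
    and top: "krein_topology D B
      = Metric_space.mtopology D (norm_dist D (induced_norm (krein_inner B Dp Dm)))"
    using krein_topology_eq[OF krein] unfolding B_def by blast
  interpret krein_decomposed D B Dp Dm
    by unfold_locales (fact B dec)+
  obtain \<alpha> where \<alpha>: "0 < \<alpha>" "\<And>x. x \<in> D \<Longrightarrow> norm x \<le> \<alpha> * K.N x"
    using cont unfolding continuously_embedded_krein_def B_def[symmetric] top
      embedding_continuous_iff[OF K.inner_space_axioms] by blast
  obtain k where k: "0 \<le> k" "\<And>x y. x \<in> D \<Longrightarrow> y \<in> D \<Longrightarrow> cmod (\<Upsilon> x y) \<le> k * K.N x * K.N y"
    using bounded_form_le[OF \<Upsilon> \<alpha>] by blast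
  have "q_closed D \<Omega> K.N"
    unfolding q_closed_def
  proof (intro conjI K.norm_on_induced K.reflexive allI impI)
    show "\<exists>\<alpha>>0. \<forall>x\<in>D. norm x \<le> \<alpha> * K.N x" using \<alpha> by blast
    fix X assume X: "(\<forall>n. X n \<in> D) \<and> (\<lambda>n. norm (X n)) \<longlonglongrightarrow> 0 \<and> K.MCauchy X"
    then obtain x where x: "K.conv X x" using K.complete K.mcomplete_iff by blast
    \<comment> \<open>The embedding estimate carries the limit \<open>x\<close> over to the ambient
      norm, where the sequence also tends to 0; so \<open>x = 0\<close>.\<close>
    have "(\<lambda>n. X n - x) \<longlonglongrightarrow> 0"
    proof (rule Lim_null_comparison)
      show "\<forall>\<^sub>F n in sequentially. norm (X n - x) \<le> \<alpha> * K.N (X n - x)"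
        using \<alpha>(2) K.conv_in[OF x] by simp
      show "(\<lambda>n. \<alpha> * K.N (X n - x)) \<longlonglongrightarrow> 0"
        using x by (auto simp: K.conv_def intro: tendsto_mult_right_zero)
    qed
    then have "X \<longlonglongrightarrow> x" by (rule LIM_zero_cancel)
    moreover have "X \<longlonglongrightarrow> 0" using X tendsto_norm_zero_iff by blast
    ultimately have "x = 0" by (rule LIMSEQ_unique)
    then show "(\<lambda>n. K.N (X n)) \<longlonglongrightarrow> 0" using x by (simp add: K.conv_def)
  next
    \<comment> \<open>\<open>B\<close> has bound 1 for the Krein norm because \<open>J\<close> is
      isometric, and \<open>\<Upsilon>\<close> has bound \<open>k\<close>.\<close>
    have "cmod (\<Omega> x y) \<le> (1 + k) * K.N x * K.N y" if xy: "x \<in> D" "y \<in> D" for x y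
    proof -
      have "cmod (\<Omega> x y) = cmod (B x y - \<Upsilon> x y)" by (simp add: B_def form_add_def)
      then show ?thesis
        using norm_triangle_ineq4[of "B x y" "\<Upsilon> x y"] B_bound[OF xy] k(2)[OF xy]
        by (simp add: algebra_simps)
    qed
    then show "\<exists>\<beta>>0. \<forall>x\<in>D. \<forall>y\<in>D. cmod (\<Omega> x y) \<le> \<beta> * K.N x * K.N y"
      by (intro exI[of _ "1 + k"]) (use k in auto)
  qed
  moreover have "\<Upsilon> \<in> solving_forms D \<Omega> K.N"
    unfolding solving_forms_def mem_Collect_eq B_def[symmetric]
  proof (intro conjI \<Upsilon> ballI impI)
    fix x assume x: "x \<in> D" and zero: "\<forall>y\<in>D. B x y = 0"
    \<comment> \<open>Testing against \<open>J x\<close> turns the indefinite form into the squared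
      norm.\<close>
    have "(K.N x)\<^sup>2 = Re (B x (J x))"
      using K_J(1)[OF x J_in[OF x]] J_J[OF x] K.norm_sq[OF x] by simp
    then show "x = 0" using zero J_in x by simp
  next
    fix \<Lambda> assume "\<Lambda> \<in> conj_dual_on D K.N"
    then obtain z where z: "z \<in> D" "\<And>y. y \<in> D \<Longrightarrow> \<Lambda> y = K z y"
      using K.conj_riesz_representation by blast
    \<comment> \<open>If \<open>z\<close> is the Riesz vector for \<open>K\<close>, then
      \<open>J z\<close> is the one for \<open>B\<close>, because \<open>J\<close> is an
      involution.\<close>
    have "\<Lambda> y = B (J z) y" if "y \<in> D" for y
      using K_J(2)[OF J_in[OF z(1)] that] J_J[OF z(1)] z(2)[OF that] by simp
    then show "\<exists>x\<in>D. \<forall>y\<in>D. \<Lambda> y = B x y" using J_in z(1) by blast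
  qed
  ultimately show thesis using that K_inner_product by blast
qed

theorem theorem7p5:
  fixes D :: "'h::chilbert_space set"
    and \<Omega> \<Upsilon> :: "'h \<Rightarrow> 'h \<Rightarrow> complex"
  assumes "csubspace D" and "closure D = UNIV"
    and "sesquilinear_on D \<Omega>"
    and "bounded_form \<Upsilon>"
    and "symmetric_form_on D (form_add \<Omega> \<Upsilon>)"
  shows "(\<exists>ip. inner_product_on D ip \<and> solvable D \<Omega> (induced_norm ip) \<and>
             \<Upsilon> \<in> solving_forms D \<Omega> (induced_norm ip)) \<longleftrightarrow>
         krein_space D (form_add \<Omega> \<Upsilon>) \<and> continuously_embedded_krein D (form_add \<Omega> \<Upsilon>)"
proof
  assume "\<exists>ip. inner_product_on D ip \<and> solvable D \<Omega> (induced_norm ip) \<and>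
    \<Upsilon> \<in> solving_forms D \<Omega> (induced_norm ip)"
  then show "krein_space D (form_add \<Omega> \<Upsilon>) \<and> continuously_embedded_krein D (form_add \<Omega> \<Upsilon>)"
    using krein_of_solvable[OF assms(1,3,4,5)] unfolding solvable_def by blast
next
  assume "krein_space D (form_add \<Omega> \<Upsilon>) \<and> continuously_embedded_krein D (form_add \<Omega> \<Upsilon>)"
  then obtain ip where "inner_product_on D ip" "q_closed D \<Omega> (induced_norm ip)"
    "\<Upsilon> \<in> solving_forms D \<Omega> (induced_norm ip)"
    using solvable_of_krein[OF assms(4)] by metis
  \<comment> \<open>\<open>\<Upsilon>\<close> itself witnesses that the set of solving forms is
    nonempty, as \<open>solvable\<close> demands.\<close>
  then show "\<exists>ip. inner_product_on D ip \<and> solvable D \<Omega> (induced_norm ip) \<and>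
    \<Upsilon> \<in> solving_forms D \<Omega> (induced_norm ip)"
    unfolding solvable_def by blast
qed

end
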